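(* Let $T^3-AT+B$ be in standard form, with $A,B\in\mathbb{F}_q[x]$, and let $\mathcal{F}=\mathbb{F}_q(x,y)$ with $y^3-Ay+B=0$. Among all pairs $(I,i)$ with $I\in\mathbb{F}_q[x]$ monic and $i\in\mathbb{F}_q[x]$ such that $$I\mid A,\qquad I\mid i^3-iA+B,\qquad I^3\mid (i^3-iA+B)^2,$$ choose one with $\deg I$ maximal. Then $$\left\{1,\ \rho=y-i,\ \omega=\frac{y^2+iy+i^2-A}{I}\right\}$$ is an $\mathbb{F}_q[x]$-basis of $\mathcal{O}_{\mathcal{F}}$, the index of $y$ is $I$, and the discriminant of $\mathcal{F}/\mathbb{F}_q(x)$ is $A^3/I^2$ (index and discriminant being understood up to multiplication by a nonzero constant and by the square of a nonzero constant, respectively).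
   Context: $q$ is a power of $3$. $A,B\in\mathbb{F}_q[x]$, $A\neq 0$, and $T^3-AT+B\in\mathbb{F}_q[x,T]$ is absolutely irreducible; $\mathcal{F}$ is the corresponding cubic extension of $\mathbb{F}_q(x)$, and $\mathcal{O}_{\mathcal{F}}$ is the integral closure of $\mathbb{F}_q[x]$ in $\mathcal{F}$. The polynomial $T^3-AT+B$ is in standard form if (a) there are no non-constant $Q\in\mathbb{F}_q[x]$ and $i\in\mathbb{F}_q[x]$ with $Q^2\mid A$ and $Q^3\mid i^3-iA+B$, and (b) either $3\nmid\deg B$ and $2\deg B>3\deg A$, or $2\deg B\le 3\deg A$. For $\alpha_0,\alpha_1,\alpha_2\in\mathcal{F}$ put $\mathrm{disc}(\alpha_0,\alpha_1,\alpha_2)=\det(\alpha_i^{(j)})^2$, where $\alpha^{(0)},\alpha^{(1)},\alpha^{(2)}$ are the conjugates of $\alpha$ over $\mathbb{F}_q(x)$. $\mathrm{disc}(\mathcal{F})$ is the discriminant of an $\mathbb{F}_q[x]$-basis of $\mathcal{O}_{\mathcal{F}}$, $\mathrm{disc}(y)=\mathrm{disc}(1,y,y^2)$, and the index of $y$ is defined by $\mathrm{disc}(y)=\mathrm{ind}(y)^2\,\mathrm{disc}(\mathcal{F})$. *)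

theory Defs
  imports
    "HOL-Algebra.Algebraic_Closure_Type"
    "HOL-Algebra.Generated_Fields"
    "HOL-Analysis.Analysis"
    "HOL-Computational_Algebra.Fraction_Field"
begin

text \<open>
  For a field of constants \<open>'a\<close>, all function fields live inside one fixed algebraic closure of
  the rational function field; an element of that closure has type \<open>'a ratfun_closure\<close>.
\<close>

type_synonym 'a ratfun_closure = "'a poly fract alg_closure"

definition of_base :: "'a::field poly \<Rightarrow> 'a ratfun_closure" where
  "of_base p = to_ac (Fract p 1)"

definition cubic :: "'a::field poly \<Rightarrow> 'a poly \<Rightarrow> 'a poly poly" where
  "cubic A B = [:B, - A, 0, 1:]"

text \<open>
  A polynomial in two variables is read as an element of \<open>'a[x][T]\<close>, and absolute irreducibility
  is irreducibility in the two-variable polynomial ring over an algebraic closure of \<open>'a\<close>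
  (not over its field of fractions). \<open>irreducible\<close> is qualified because HOL-Algebra has its own.
\<close>

definition absolutely_irreducible :: "'a::field poly poly \<Rightarrow> bool" where
  "absolutely_irreducible P \<longleftrightarrow>
     Factorial_Ring.irreducible (map_poly (map_poly (to_ac :: 'a \<Rightarrow> 'a alg_closure)) P)"

definition standard_form :: "'a::field poly \<Rightarrow> 'a poly \<Rightarrow> bool" where
  "standard_form A B \<longleftrightarrow>
     \<not> (\<exists>Q i. degree Q > 0 \<and> Q ^ 2 dvd A \<and> Q ^ 3 dvd i ^ 3 - i * A + B) \<and>
     (\<not> 3 dvd degree B \<and> 2 * degree B > 3 * degree A \<or> 2 * degree B \<le> 3 * degree A)"

definition adjoin :: "'a::field ratfun_closure \<Rightarrow> 'a ratfun_closure set" where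
  "adjoin y = generate_field ring_of_type_algebra (insert y (range to_ac))"

definition integral_closure_in :: "'a::field ratfun_closure set \<Rightarrow> 'a ratfun_closure set" where
  "integral_closure_in F =
     {z \<in> F. \<exists>p :: 'a poly poly. lead_coeff p = 1 \<and> poly (map_poly of_base p) z = 0}"

definition poly_scale :: "'a::field poly \<Rightarrow> 'a ratfun_closure \<Rightarrow> 'a ratfun_closure" where
  "poly_scale p z = of_base p * z"

lemma module_poly_scale: "Modules.module poly_scale"
proof
  have add: "of_base (p + q) = of_base p + of_base q" for p q :: "'a poly"
    by (simp add: of_base_def flip: to_ac_add)
  have mult: "of_base (p * q) = of_base p * of_base q" for p q :: "'a poly"
    by (simp add: of_base_def flip: to_ac_mult)
  fix p q :: "'a poly" and z w :: "'a ratfun_closure"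
  show "poly_scale p (z + w) = poly_scale p z + poly_scale p w"
    by (simp add: poly_scale_def algebra_simps)
  show "poly_scale (p + q) z = poly_scale p z + poly_scale q z"
    by (simp add: poly_scale_def add algebra_simps)
  show "poly_scale p (poly_scale q z) = poly_scale (p * q) z"
    by (simp add: poly_scale_def mult)
  show "poly_scale 1 z = z"
    by (simp add: poly_scale_def of_base_def flip: One_fract_def)
qed

text \<open>
  \<open>span\<close> and \<open>dependent\<close> speak about sets of vectors, so the triple must in addition be free of
  repetitions.
\<close>

definition is_poly_basis :: "'a::field ratfun_closure set \<Rightarrow> 'a ratfun_closure ^ 3 \<Rightarrow> bool" where
  "is_poly_basis M b \<longleftrightarrow>
     inj (\<lambda>k. b $ k) \<and>
     \<not> Modules.module.dependent poly_scale (range (\<lambda>k. b $ k)) \<and>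
     Modules.module.span poly_scale (range (\<lambda>k. b $ k)) = M"

text \<open>
  The embeddings of \<open>F\<close> into the algebraic closure over the rational function field; the
  conjugates of \<open>z \<in> F\<close> are its images under them. Functions are cut off outside \<open>F\<close>, so that each
  embedding is counted once.
\<close>

definition embeddings ::
    "'a::field ratfun_closure set \<Rightarrow> ('a ratfun_closure \<Rightarrow> 'a ratfun_closure) set" where
  "embeddings F =
     {\<sigma> \<in> extensional F. \<sigma> \<in> ring_hom (ring_of_type_algebra\<lparr>carrier := F\<rparr>) ring_of_type_algebra \<and>
        (\<forall>r. \<sigma> (to_ac r) = to_ac r)}"

text \<open>
  Only meaningful when \<open>F\<close> has exactly three embeddings (a separable cubic extension); then the
  chosen enumeration is irrelevant by \<open>disc_eq\<close> below.
\<close>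

definition disc :: "'a::field ratfun_closure set \<Rightarrow> 'a ratfun_closure ^ 3 \<Rightarrow> 'a ratfun_closure" where
  "disc F v =
     (let s = (SOME s :: 3 \<Rightarrow> 'a ratfun_closure \<Rightarrow> 'a ratfun_closure.
                 bij_betw s UNIV (embeddings F))
      in (det (\<chi> k j. s j (v $ k))) ^ 2)"

lemma disc_eq:
  fixes s :: "3 \<Rightarrow> 'a::field ratfun_closure \<Rightarrow> 'a ratfun_closure"
  assumes s: "bij_betw s UNIV (embeddings F)"
  shows "disc F v = (det (\<chi> k j. s j (v $ k))) ^ 2"
proof -
  define t where "t = (SOME t :: 3 \<Rightarrow> 'a ratfun_closure \<Rightarrow> 'a ratfun_closure.
                 bij_betw t UNIV (embeddings F))"
  have t: "bij_betw t UNIV (embeddings F)"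
    unfolding t_def using s by (rule someI[of "\<lambda>t. bij_betw t UNIV (embeddings F)" s])
  define p where "p = inv_into UNIV s \<circ> t"
  have "bij p"
    unfolding p_def using bij_betw_trans[OF t bij_betw_inv_into[OF s]] .
  then have perm: "p permutes UNIV"
    by (auto simp: permutes_def bij_iff)
  have sp: "s (p j) = t j" for j
    unfolding p_def comp_def
    by (rule bij_betw_inv_into_right[OF s]) (use t in \<open>auto simp: bij_betw_def\<close>)
  have "det (\<chi> k j. t j (v $ k)) = of_int (sign p) * det (\<chi> k j. s j (v $ k))"
    using det_permute_columns[OF perm, of "\<chi> k j. s j (v $ k)"] by (simp add: sp)
  moreover have "(of_int (sign p) :: 'a ratfun_closure) ^ 2 = 1"
    by (simp add: sign_def)
  ultimately show ?thesis
    unfolding disc_def Let_def t_def[symmetric] by (simp add: power_mult_distrib)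
qed

text \<open>
  Discriminant and index are only defined up to constants, so they are represented by the sets of
  all their admissible values: one discriminant for each basis of the ring of integers, and for each
  of these the square roots of the corresponding quotient of discriminants.
\<close>

definition discriminants :: "'a::field ratfun_closure set \<Rightarrow> 'a ratfun_closure set" where
  "discriminants F = {disc F b | b. is_poly_basis (integral_closure_in F) b}"

definition indices :: "'a::field ratfun_closure set \<Rightarrow> 'a ratfun_closure \<Rightarrow> 'a ratfun_closure set" where
  "indices F z = {J. \<exists>d \<in> discriminants F. disc F (vector [1, z, z ^ 2]) = J ^ 2 * d}"

definition admissible :: "'a::field poly \<Rightarrow> 'a poly \<Rightarrow> 'a poly \<Rightarrow> 'a poly \<Rightarrow> bool" where
  "admissible A B I i \<longleftrightarrow>
     lead_coeff I = 1 \<and> I dvd A \<and> I dvd i ^ 3 - i * A + B \<and> I ^ 3 dvd (i ^ 3 - i * A + B) ^ 2"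

end

theory Submission
  imports Defs
begin

text \<open>
  Put \<open>N = i\<^sup>3 - i A + B\<close>. Then \<open>\<rho> = y - i\<close> is a root of \<open>T\<^sup>3 - A T + N\<close>, and \<open>\<omega> = (\<rho>\<^sup>2 - A) / I\<close> because
  \<open>y\<^sup>2 + i y + i\<^sup>2 = (y - i)\<^sup>2\<close> in characteristic three. In this characteristic \<open>T\<^sup>3 - A T\<close> is additive, so
  the conjugates of \<open>\<rho>\<close> are \<open>\<rho>\<close> and \<open>\<rho> \<plusminus> s\<close> with \<open>s\<^sup>2 = A\<close>. Two things follow. The Vandermonde
  determinant of the three conjugates is \<open>2 s\<^sup>3\<close>, so \<open>disc(1, y, y\<^sup>2) = A\<^sup>3\<close>
  and \<open>disc(1, \<rho>, \<omega>) = A\<^sup>3 / I\<^sup>2\<close>. And the coefficients of the characteristic polynomial of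
  \<open>a + b \<rho> + c \<omega>\<close> are short polynomials in \<open>a, b, c\<close>: with \<open>m = A / I\<close> they are, up to sign,
  \<open>m c\<close>, \<open>a c m - b\<^sup>2 A\<close> and a cubic form (\<open>lattice_norm\<close>).

  An element of the field is integral precisely when these three coefficients are polynomials: by
  Cayley-Hamilton in one direction, and by Gauss's lemma in the other, since the characteristic polynomial
  divides the cube of any polynomial over the base field that annihilates the element. So the elements with \<open>a, b, c\<close>
  polynomials are integral. That there are no others is shown one prime at a time (\<open>denominator_dvd\<close>):
  if \<open>(a + b \<rho> + c \<omega>) / P\<close> is integral for a prime \<open>P\<close>, then \<open>P\<close> divides \<open>a, b, c\<close>. There are three cases.

  \<^item> \<open>P\<close> does not divide \<open>m\<close>. The trace gives \<open>P dvd c\<close>, and the other coefficients give the rest,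
    because \<open>P\<^sup>2\<close> does not divide \<open>I\<close>.

  \<^item> \<open>P\<close> divides \<open>m\<close> but not \<open>I\<close>. The residue field is finite, hence perfect, so some
    \<open>j\<close> satisfies \<open>P dvd j\<^sup>3 - j A + B\<close>. If \<open>P\<^sup>2\<close> divided this number, then \<open>(I P, k)\<close>, with \<open>k\<close>
    congruent to \<open>i\<close> modulo \<open>I\<^sup>3\<close> and to \<open>j\<close> modulo \<open>P\<^sup>2\<close>, would be an admissible pair of larger
    degree. Hence the polynomial of \<open>y - j\<close> is Eisenstein at \<open>P\<close>.

  \<^item> \<open>P\<close> divides both. Then \<open>P\<^sup>2\<close> divides \<open>A\<close>, and the standard form forbids \<open>P\<^sup>3 dvd N\<close>. This makes
    the polynomial of \<open>\<omega>\<close> Eisenstein at \<open>P\<close>.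

  In the last two cases the norm form alone gives the result, by comparing its terms modulo \<open>P\<close>, \<open>P\<^sup>2\<close> and \<open>P\<^sup>3\<close>.

  Finally, two bases differ by a matrix whose determinant is a nonzero constant \<open>c\<close>, which multiplies the
  discriminant by \<open>c\<^sup>2\<close>. Comparing with \<open>disc(1, y, y\<^sup>2)\<close> gives the index.
\<close>

section \<open>Prime factors, residues and Gauss's lemma for polynomials over a field\<close>

text \<open>
  A non-constant divisor of least degree is irreducible.
\<close>

lemma exists_monic_prime_factor:
  fixes d :: "'a::field poly"
  assumes "degree d > 0"
  obtains P where "lead_coeff P = 1" "degree P > 0" "prime_elem P" "P dvd d"
proof -
  obtain P0 where P0: "P0 dvd d" "degree P0 > 0"
    and min: "\<And>Q. Q dvd d \<Longrightarrow> degree Q > 0 \<Longrightarrow> degree P0 \<le> degree Q"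
    using ex_has_least_nat[of "\<lambda>P. P dvd d \<and> degree P > 0" d degree] assms by auto
  define c where "c = inverse (lead_coeff P0)"
  have c: "c \<noteq> 0" using P0 by (auto simp: c_def)
  have "irreducible (smult c P0)"
  proof (rule irreducibleI)
    show "smult c P0 \<noteq> 0" using c P0 by auto
    have "degree (smult c P0) \<noteq> 0" using c P0 by simp
    then show "\<not> smult c P0 dvd 1"
      using is_unit_iff_degree[OF \<open>smult c P0 \<noteq> 0\<close>] by simp
  next
    fix a b assume ab: "smult c P0 = a * b"
    have nz: "a \<noteq> 0" "b \<noteq> 0" using ab c P0 by auto
    have "a dvd d"
      using ab c P0(1) by (metis dvd_smult_cancel dvd_triv_left dvd_trans smult_dvd_iff)
    moreover have "degree a + degree b = degree P0"
      using ab c nz by (metis degree_mult_eq degree_smult_eq)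
    ultimately have "degree a = 0 \<or> degree b = 0"
      using min[of a] by linarith
    then show "a dvd 1 \<or> b dvd 1" using nz by (simp add: is_unit_iff_degree)
  qed
  then have "prime_elem (smult c P0)" by (rule field_poly_irreducible_imp_prime)
  then show thesis
    using that[of "smult c P0"] P0 c by (auto simp: c_def smult_dvd_iff)
qed

lemma prime_elem_power_dvd_mult_cancel:
  fixes p :: "'a::idom"
  assumes "prime_elem p" "\<not> p dvd a" "p ^ n dvd a * b"
  shows "p ^ n dvd b"
  using assms(3)
proof (induction n arbitrary: b)
  case (Suc n)
  have "p dvd a * b" using Suc.prems by (metis dvd_mult_left power_Suc)
  then obtain b' where b: "b = p * b'"
    using assms by (auto simp: prime_elem_dvd_mult_iff)
  have "p * p ^ n dvd p * (a * b')" using Suc.prems by (simp add: b ac_simps)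
  then have "p ^ n dvd a * b'" using assms(1) by (simp add: prime_elem_def)
  then show ?case using Suc.IH[of b'] by (simp add: b)
qed simp

lemma finite_polys_degree_less: "finite {p :: 'a::{finite,zero} poly. degree p < n}"
proof (rule inj_on_finite)
  show "inj_on (\<lambda>p :: 'a poly. map (coeff p) [0..<n]) {p. degree p < n}"
  proof (rule inj_onI, rule poly_eqI)
    fix p q :: "'a poly" and k
    assume pq: "p \<in> {p. degree p < n}" "q \<in> {p. degree p < n}"
      "map (coeff p) [0..<n] = map (coeff q) [0..<n]"
    show "coeff p k = coeff q k"
      using pq by (cases "k < n") (auto simp: coeff_eq_0)
  qed
  show "finite {xs :: 'a list. set xs \<subseteq> UNIV \<and> length xs = n}"
    by (rule finite_lists_length_eq) simp
qed auto

text \<open>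
  Residues modulo \<open>M\<close> form a finite set. This one counting argument provides both cube roots modulo a
  prime and solutions of simultaneous congruences.
\<close>

lemma injective_mod_imp_surjective_mod:
  fixes M :: "'a::{field,finite} poly"
  assumes "M \<noteq> 0" and inj: "\<And>r r'. M dvd f r - f r' \<Longrightarrow> M dvd r - r'"
  shows "\<exists>r. M dvd f r - t"
proof (cases "degree M = 0")
  case True
  then show ?thesis using assms(1) by (metis is_unit_iff_degree unit_imp_dvd)
next
  case False
  define S where "S = {p :: 'a poly. degree p < degree M}"
  have S: "p mod M \<in> S" for p
    using degree_mod_less'[of M p] False assms(1) by (cases "p mod M = 0") (auto simp: S_def)
  have "inj_on (\<lambda>r. f r mod M) S"
  proof (rule inj_onI)
    fix r r' assume r: "r \<in> S" "r' \<in> S" "f r mod M = f r' mod M"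
    have "f r mod M = f r' mod M" using r(3) .
    then have "M dvd r - r'" by (rule inj[OF iffD1[OF mod_eq_dvd_iff]])
    moreover have "degree (r - r') < degree M" using r by (auto simp: S_def intro: degree_diff_less)
    ultimately show "r = r'" by (metis dvd_imp_degree_le eq_iff_diff_eq_0 leD)
  qed
  then have "(\<lambda>r. f r mod M) ` S = S"
    using S by (intro endo_inj_surj) (auto simp: S_def finite_polys_degree_less)
  then obtain r where "f r mod M = t mod M" using S[of t] by (metis (no_types, lifting) imageE)
  then have "M dvd f r - t" by (simp only: mod_eq_dvd_iff)
  then show ?thesis ..
qed

text \<open>
  Gauss's lemma without contents: every prime factor of \<open>c\<close> divides
  \<open>G\<close> or \<open>H\<close> and can be cancelled there, until \<open>c\<close> is a unit. Then the leading coefficient of \<open>G\<close>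
  is a unit as well.
\<close>

lemma lead_coeff_dvd_factor_of_monic:
  fixes c :: "'a::field poly" and G H P :: "'a poly poly"
  assumes "c \<noteq> 0" "G * H = smult c P" "lead_coeff P = 1"
  shows "\<exists>G'. G = smult (lead_coeff G) G'"
  using assms(1,2)
proof (induction "degree c" arbitrary: c G H rule: less_induct)
  case less
  show ?case
  proof (cases "degree c = 0")
    case True
    have "lead_coeff G * lead_coeff H = c"
      using arg_cong[OF less.prems(2), of lead_coeff] assms(3) by (simp add: lead_coeff_mult)
    moreover have "c dvd 1" using True less.prems by (simp add: is_unit_iff_degree)
    ultimately obtain u where "lead_coeff G * u = 1"
      by (metis dvdE dvd_mult_left)
    then have "G = smult (lead_coeff G) (smult u G)" by (simp add: mult.commute)
    then show ?thesis ..
  next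
    case False
    then have "degree c > 0" by simp
    then obtain p where p: "lead_coeff p = 1" "degree p > 0" "prime_elem p" "p dvd c"
      by (rule exists_monic_prime_factor)
    then obtain c' where c': "c = p * c'" by blast
    have nz: "p \<noteq> 0" "c' \<noteq> 0" using c' less.prems by auto
    have less': "degree c' < degree c" using p nz by (simp add: c' degree_mult_eq)
    have "[:p:] dvd G * H" by (simp add: less.prems(2) c' const_poly_dvd_iff)
    then consider "[:p:] dvd G" | "[:p:] dvd H"
      using p(3) by (metis lift_prime_elem_poly prime_elem_dvd_multD)
    then show ?thesis
    proof cases
      case 1
      then obtain G1 where G: "G = smult p G1" by auto
      have "smult p (G1 * H) = smult p (smult c' P)" using less.prems(2) by (simp add: G c')
      then have "G1 * H = smult c' P" by (rule smult_cancel[OF nz(1)])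
      then obtain G' where "G1 = smult (lead_coeff G1) G'" using less.hyps[OF less'] nz by blast
      then have "G = smult (lead_coeff G) G'" by (metis G lead_coeff_smult smult_smult)
      then show ?thesis ..
    next
      case 2
      then obtain H1 where H: "H = smult p H1" by auto
      have "smult p (G * H1) = smult p (smult c' P)" using less.prems(2) by (simp add: H c')
      then have "G * H1 = smult c' P" by (rule smult_cancel[OF nz(1)])
      then show ?thesis using less.hyps[OF less'] nz by blast
    qed
  qed
qed

lemma clear_denominators:
  fixes U :: "'a::idom fract poly"
  obtains d :: 'a and G :: "'a poly" where "d \<noteq> 0" "smult (to_fract d) U = map_poly to_fract G"
proof (induction U arbitrary: thesis)
  case 0
  show ?case using 0[of 1 0] by simp
next
  case (pCons x U)
  obtain d G where dG: "d \<noteq> 0" "smult (to_fract d) U = map_poly to_fract G"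
    using pCons.IH by blast
  obtain a b where x: "x = Fract a b" "b \<noteq> 0" by (cases x) auto
  have "to_fract (b * d) * x = to_fract (d * a)"
    using x by (simp add: Fract_conv_to_fract)
  moreover have "smult (to_fract (b * d)) U = map_poly to_fract (smult b G)"
    by (simp flip: dG(2))
  ultimately have "smult (to_fract (b * d)) (pCons x U) = map_poly to_fract (pCons (d * a) (smult b G))"
    by (simp add: map_poly_pCons del: fract_poly_smult to_fract_mult)
  then show ?case using pCons.prems[of "b * d"] x dG by auto
qed

text \<open>
  This is the integral closedness of the polynomial ring, in the form used twice below: for
  linear factors (rational roots) and for characteristic polynomials.
\<close>

lemma monic_factor_of_integral_poly:
  fixes U H :: "'a::field poly fract poly" and P :: "'a poly poly"
  assumes "U * H = map_poly to_fract P" "lead_coeff P = 1" "lead_coeff U = 1"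
  obtains G where "U = map_poly to_fract G"
proof -
  obtain d G where d: "d \<noteq> 0" "smult (to_fract d) U = map_poly to_fract G"
    by (rule clear_denominators)
  obtain e J where e: "e \<noteq> 0" "smult (to_fract e) H = map_poly to_fract J"
    by (rule clear_denominators)
  have "map_poly to_fract (G * J) = map_poly to_fract (smult (d * e) P)"
    by (simp add: mult.commute flip: d(2) e(2) assms(1))
  then have "G * J = smult (d * e) P" by (simp del: fract_poly_smult fract_poly_mult)
  then obtain G' where G': "G = smult (lead_coeff G) G'"
    using lead_coeff_dvd_factor_of_monic[of "d * e" G J P] d e assms(2) by auto
  have "to_fract (lead_coeff G) = to_fract d"
    using arg_cong[OF d(2), of lead_coeff] assms(3) d(1)
    by (simp add: coeff_map_poly degree_map_poly)
  then have "smult (to_fract d) U = smult (to_fract d) (map_poly to_fract G')"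
    using d(2) G' by (metis fract_poly_smult to_fract_eq_iff)
  then have "U = map_poly to_fract G'" using smult_cancel[of "to_fract d"] d(1) by simp
  then show thesis by (rule that)
qed

text \<open>
  Translation by one permutes the ring, so it leaves the sum of all elements unchanged.
\<close>

lemma of_nat_card_eq_0: "of_nat (CARD('a::{ring_1,finite})) = (0::'a)"
proof -
  have "(\<Sum>x\<in>UNIV. x + 1 :: 'a) = (\<Sum>x\<in>UNIV. x)"
    by (rule sum.reindex_bij_witness[of _ "\<lambda>x. x - 1" "\<lambda>x. x + 1"]) auto
  then show ?thesis by (simp add: sum.distrib)
qed

lemma three_eq_0_if_card_power_3:
  assumes "CARD('a::{field,finite}) = 3 ^ n"
  shows "(3::'a) = 0"
  using of_nat_card_eq_0[where 'a='a] by (simp add: assms)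

lemma cube_add:
  assumes "(3::'a::idom) = 0"
  shows "(a + b) ^ 3 = a ^ 3 + (b::'a) ^ 3"
proof -
  have "(a + b) ^ 3 = a ^ 3 + b ^ 3 + 3 * (a\<^sup>2 * b + a * b\<^sup>2)" by Groebner_Basis.algebra
  then show ?thesis using assms by simp
qed

lemma cube_diff:
  assumes "(3::'a::idom) = 0"
  shows "(a - b) ^ 3 = a ^ 3 - (b::'a) ^ 3"
  using cube_add[OF assms, of "a - b" b] by simp

lemma prime_elem_power_dvd_square:
  fixes p :: "'a::idom"
  assumes "prime_elem p" "p ^ (2 * k) dvd x ^ 2"
  shows "p ^ k dvd x"
  using assms(2)
proof (induction k arbitrary: x)
  case (Suc k)
  have "p dvd x ^ 2" by (rule dvd_trans[OF _ Suc.prems]) simp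
  then obtain x' where x: "x = p * x'" using prime_elem_dvd_power[OF assms(1)] by blast
  have "p ^ 2 * p ^ (2 * k) dvd p ^ 2 * x' ^ 2"
    using Suc.prems by (simp add: x power_mult_distrib flip: power_add)
  then have "p ^ (2 * k) dvd x' ^ 2" using assms(1) by (simp add: prime_elem_def)
  then show ?case using Suc.IH[of x'] by (simp add: x)
qed simp

lemma prime_elem_dvd_mult_powerD:
  assumes "prime_elem p" "p dvd x * y ^ k" "\<not> p dvd x"
  shows "p dvd y"
  using assms prime_elem_dvd_multD prime_elem_dvd_power by blast

section \<open>The norm form of a cubic in characteristic three\<close>

definition cubic_at :: "'a::idom \<Rightarrow> 'a \<Rightarrow> 'a \<Rightarrow> 'a" where
  "cubic_at A B i = i ^ 3 - i * A + B"

lemma dvd_cubic_at_diff: "d dvd i - j \<Longrightarrow> d dvd cubic_at A B i - cubic_at A B j"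
proof -
  assume "d dvd i - j"
  then have "d dvd (i - j) * (i\<^sup>2 + i * j + j\<^sup>2 - A)" by (rule dvd_mult2)
  also have "\<dots> = cubic_at A B i - cubic_at A B j" unfolding cubic_at_def by Groebner_Basis.algebra
  finally show ?thesis .
qed

text \<open>
  The norm of \<open>a + b t + c t\<^sup>2\<close> for a root \<open>t\<close> of \<open>T\<^sup>3 - A T + B\<close> in characteristic three.
\<close>

definition norm_form :: "'a::idom \<Rightarrow> 'a \<Rightarrow> 'a \<Rightarrow> 'a \<Rightarrow> 'a \<Rightarrow> 'a" where
  "norm_form A B a b c =
     a ^ 3 + 2 * A * a\<^sup>2 * c + a * (A\<^sup>2 * c\<^sup>2 - A * b\<^sup>2) - B * b ^ 3 + B * A * b * c\<^sup>2 + B\<^sup>2 * c ^ 3"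

text \<open>
  The norm does not depend on whether an element is written in terms of \<open>t\<close> or of \<open>t - e\<close>. Over the
  integers the two sides differ by three times the polynomial given in the proof.
\<close>

lemma norm_form_shift:
  fixes A B a b c e :: "'a::idom"
  assumes "(3::'a) = 0"
  shows "norm_form A (B + e ^ 3 - e * A) (a + b * e + c * e\<^sup>2) (b + 2 * c * e) c = norm_form A B a b c"
proof -
  have "norm_form A (B + e ^ 3 - e * A) (a + b * e + c * e\<^sup>2) (b + 2 * c * e) c = norm_form A B a b c
    + 3 * (a^2*b*e + a^2*c*e^2 + a*b^2*e^2 + 2*a*b*c*e^3 + a*c^2*e^4 - b^2*c*e^4 - 3*b*c^2*e^5 - 2*c^3*e^6
      + A*b^2*c*e^2 + 3*A*b*c^2*e^3 + 2*A*c^3*e^4 - 2*B*b^2*c*e - 4*B*b*c^2*e^2 - 2*B*c^3*e^3)"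
    unfolding norm_form_def by Groebner_Basis.algebra
  then show ?thesis using assms by simp
qed

text \<open>
  For an Eisenstein polynomial at \<open>P\<close>, the norms of the three terms \<open>a\<close>, \<open>b t\<close>, \<open>c t\<^sup>2\<close> have valuations
  congruent to 0, 1, 2 modulo 3, so they cannot cancel. Reading the form modulo \<open>P\<close>, \<open>P\<^sup>2\<close>
  and \<open>P\<^sup>3\<close> in turn makes \<open>a\<close>, \<open>b\<close> and \<open>c\<close> divisible by \<open>P\<close>.
\<close>

lemma prime_elem_Eisenstein_norm_form:
  fixes P :: "'a::idom"
  assumes P: "prime_elem P" and A: "P dvd A" and B: "P dvd B" "\<not> P ^ 2 dvd B"
    and nf: "P ^ 3 dvd norm_form A B a b c"
  shows "P dvd a \<and> P dvd b \<and> P dvd c"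
proof -
  have nz: "P \<noteq> 0" using P by auto
  obtain A1 B1 k where A1: "A = P * A1" and B1: "B = P * B1" and k: "norm_form A B a b c = P ^ 3 * k"
    using A B nf by (auto elim!: dvdE)
  have nB1: "\<not> P dvd B1" using B(2) nz by (simp add: B1 power2_eq_square)
  have "a ^ 3 = P * (P ^ 2 * k - 2*A1*a\<^sup>2*c - a*(P*A1\<^sup>2*c\<^sup>2 - A1*b\<^sup>2) + B1*b^3 - P*B1*A1*b*c\<^sup>2 - P*B1\<^sup>2*c^3)"
    using k unfolding norm_form_def A1 B1 by Groebner_Basis.algebra
  then have "P dvd a ^ 3" by simp
  then obtain a1 where a1: "a = P * a1" using prime_elem_dvd_power[OF P] by blast
  have "P * (B1 * b ^ 3) = P * (P * (- P*k + P*a1^3 + 2*P*A1*a1\<^sup>2*c + a1*(P*A1\<^sup>2*c\<^sup>2 - A1*b\<^sup>2)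
      + B1*A1*b*c\<^sup>2 + B1\<^sup>2*c^3))"
    using k unfolding norm_form_def A1 B1 a1 by Groebner_Basis.algebra
  then have "B1 * b ^ 3 = P * (- P*k + P*a1^3 + 2*P*A1*a1\<^sup>2*c + a1*(P*A1\<^sup>2*c\<^sup>2 - A1*b\<^sup>2)
      + B1*A1*b*c\<^sup>2 + B1\<^sup>2*c^3)"
    using nz by simp
  then have "P dvd B1 * b ^ 3" by simp
  then obtain b1 where b1: "b = P * b1" using prime_elem_dvd_mult_powerD[OF P] nB1 by blast
  have "P\<^sup>2 * (B1\<^sup>2 * c ^ 3) = P\<^sup>2 * (P * (k - a1^3 - 2*A1*a1\<^sup>2*c - a1*(A1\<^sup>2*c\<^sup>2 - P*A1*b1\<^sup>2)
      + P*B1*b1^3 - B1*A1*b1*c\<^sup>2))"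
    using k unfolding norm_form_def A1 B1 a1 b1 by Groebner_Basis.algebra
  then have "B1\<^sup>2 * c ^ 3 = P * (k - a1^3 - 2*A1*a1\<^sup>2*c - a1*(A1\<^sup>2*c\<^sup>2 - P*A1*b1\<^sup>2)
      + P*B1*b1^3 - B1*A1*b1*c\<^sup>2)"
    using nz by simp
  then have "P dvd B1\<^sup>2 * c ^ 3" by simp
  moreover have "\<not> P dvd B1\<^sup>2" using nB1 prime_elem_dvd_power[OF P] by blast
  ultimately have "P dvd c" using prime_elem_dvd_mult_powerD[OF P] by blast
  then show ?thesis using a1 b1 by simp
qed

text \<open>
  Cubing is additive in characteristic three, hence injective modulo a prime, hence surjective.
\<close>

lemma exists_cube_mod_prime:
  fixes P :: "'a::{field,finite} poly"
  assumes "(3::'a) = 0" "prime_elem P"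
  shows "\<exists>r. P dvd r ^ 3 - t"
proof (rule injective_mod_imp_surjective_mod)
  show "P \<noteq> 0" using assms by auto
  fix r r' :: "'a poly"
  have three: "(3::'a poly) = 0" using assms(1) by (metis numeral_poly pCons_0_0)
  assume "P dvd r ^ 3 - r' ^ 3"
  then have "P dvd (r - r') ^ 3" by (simp add: cube_diff[OF three])
  then show "P dvd r - r'" using prime_elem_dvd_power[OF assms(2)] by blast
qed

lemma exists_cong_prime_power_and_multiple:
  fixes P :: "'a::{field,finite} poly"
  assumes "prime_elem P" "\<not> P dvd M"
  shows "\<exists>k. M dvd k - i \<and> P ^ n dvd k - j"
proof -
  have "\<exists>r. P ^ n dvd M * r - (j - i)"
  proof (rule injective_mod_imp_surjective_mod)
    show "P ^ n \<noteq> 0" using assms by auto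
    fix r r' assume "P ^ n dvd M * r - M * r'"
    then have "P ^ n dvd M * (r - r')" by (simp add: algebra_simps)
    then show "P ^ n dvd r - r'" by (rule prime_elem_power_dvd_mult_cancel[OF assms])
  qed
  then obtain r where "P ^ n dvd M * r - (j - i)" ..
  then have "M dvd (i + M * r) - i \<and> P ^ n dvd (i + M * r) - j" by (simp add: algebra_simps)
  then show ?thesis ..
qed

section \<open>Primes dividing a denominator\<close>

text \<open>
  The norm of \<open>a + b \<rho> + c \<omega>\<close>, with \<open>A = m I\<close>, \<open>N = n I\<close> and \<open>w = N\<^sup>2 / I\<^sup>3\<close>; admissibility of the pair
  says exactly that \<open>m\<close>, \<open>n\<close>, \<open>w\<close> are polynomials.
\<close>

definition lattice_norm :: "'a::idom \<Rightarrow> 'a \<Rightarrow> 'a \<Rightarrow> 'a \<Rightarrow> 'a \<Rightarrow> 'a \<Rightarrow> 'a \<Rightarrow> 'a" where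
  "lattice_norm I m n w a b c = a ^ 3 - m * a\<^sup>2 * c - m * I * a * b\<^sup>2 + m\<^sup>2 * I * b\<^sup>2 * c
     - n * I * b ^ 3 + n * m * b * c\<^sup>2 + w * c ^ 3"

text \<open>
  The assumption \<open>not_both\<close> is part (a) of the standard form; the quotients of \<open>A\<close>, \<open>N\<close> and \<open>N\<^sup>2\<close> are parameters
  because every identity below is one between them.
\<close>

locale maximal_admissible =
  fixes A B I i N m n w :: "'a::{field,finite} poly"
  assumes three: "(3::'a) = 0"
    and N_def: "N = cubic_at A B i"
    and I_nz: "I \<noteq> 0"
    and A_eq: "A = m * I" and N_eq: "N = n * I" and w_eq: "N\<^sup>2 = w * I ^ 3"
    and not_both: "\<And>Q j. degree Q > 0 \<Longrightarrow> Q ^ 2 dvd A \<Longrightarrow> \<not> Q ^ 3 dvd cubic_at A B j"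
    and adm: "admissible A B I i"
    and max_deg: "\<And>I' i'. admissible A B I' i' \<Longrightarrow> degree I' \<le> degree I"
begin

lemma three_poly: "(3::'a poly) = 0"
  using three by (metis numeral_poly pCons_0_0)

lemma n_square: "n\<^sup>2 = w * I"
proof -
  have "I\<^sup>2 * n\<^sup>2 = I\<^sup>2 * (w * I)"
    using w_eq N_eq by Groebner_Basis.algebra
  then show ?thesis using I_nz by simp
qed

text \<open>
  If \<open>P\<^sup>2\<close> divided \<open>I\<close>, then \<open>P\<^sup>6\<close> would divide \<open>N\<^sup>2\<close>, so \<open>P\<^sup>2 dvd A\<close> and \<open>P\<^sup>3 dvd N\<close>, against the
  standard form.
\<close>

lemma square_not_dvd_I:
  assumes "prime_elem P" "degree P > 0"
  shows "\<not> P\<^sup>2 dvd I"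
proof
  assume P2: "P\<^sup>2 dvd I"
  have "P\<^sup>2 dvd A" using P2 by (simp add: A_eq)
  have "(P\<^sup>2) ^ 3 dvd N\<^sup>2" unfolding w_eq using P2 by (intro dvd_mult dvd_power_same)
  then have "P ^ (2 * 3) dvd N\<^sup>2" by (simp flip: power_mult)
  then have "P ^ 3 dvd N" using prime_elem_power_dvd_square[OF assms(1)] by blast
  then show False using not_both[OF assms(2) \<open>P\<^sup>2 dvd A\<close>] by (simp add: N_def)
qed

text \<open>
  This is where the maximality of the degree of \<open>I\<close> enters: otherwise the Chinese remainder theorem
  enlarges \<open>I\<close> to \<open>I P\<close>.
\<close>

lemma square_not_dvd_cubic_at:
  assumes P: "prime_elem P" "lead_coeff P = 1" "degree P > 0"
    and "P dvd A" "\<not> P dvd I"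
  shows "\<not> P\<^sup>2 dvd cubic_at A B j"
proof
  assume j: "P\<^sup>2 dvd cubic_at A B j"
  have "\<not> P dvd I ^ 3" using assms prime_elem_dvd_power[OF P(1)] by blast
  then obtain k where k: "I ^ 3 dvd k - i" "P\<^sup>2 dvd k - j"
    using exists_cong_prime_power_and_multiple[OF P(1)] by blast
  define N' where "N' = cubic_at A B k"
  have "I ^ 3 dvd N' - N" using dvd_cubic_at_diff[OF k(1)] by (simp add: N'_def N_def)
  then obtain x where x: "N' = N + I ^ 3 * x" by (metis add.commute diff_add_cancel dvdE)
  have "P\<^sup>2 dvd N' - cubic_at A B j" using dvd_cubic_at_diff[OF k(2)] by (simp add: N'_def)
  then have "P\<^sup>2 dvd N' - cubic_at A B j + cubic_at A B j" using j by (rule dvd_add)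
  then have P2: "P\<^sup>2 dvd N'" by simp
  have "N' = I * (n + I\<^sup>2 * x)" using x N_eq by Groebner_Basis.algebra
  then have "P\<^sup>2 dvd I * (n + I\<^sup>2 * x)" "I dvd N'" using P2 by auto
  then have "P dvd n + I\<^sup>2 * x"
    using prime_elem_power_dvd_mult_cancel[OF P(1) assms(5), of 2 "n + I\<^sup>2 * x"]
    by (metis dvd_mult_left power2_eq_square)
  then have IP: "I * P dvd N'" using \<open>N' = I * (n + I\<^sup>2 * x)\<close> by simp
  have "P dvd m * I" using assms by (simp add: A_eq)
  then have "P dvd m" using assms by (simp add: prime_elem_dvd_mult_iff)
  then have IPA: "I * P dvd A" by (simp add: A_eq)
  define u where "u = w + 2 * N * x + I ^ 3 * x\<^sup>2"
  have u: "N'\<^sup>2 = I ^ 3 * u" unfolding u_def using x w_eq by Groebner_Basis.algebra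
  have "P ^ 4 dvd N'\<^sup>2"
    using mult_dvd_mono[OF P2 P2] by (simp flip: power_add power2_eq_square)
  then have "P ^ 3 dvd I ^ 3 * u"
    unfolding u using le_imp_power_dvd[of 3 4 P] dvd_trans by auto
  then have "P ^ 3 dvd u" using prime_elem_power_dvd_mult_cancel[OF P(1) \<open>\<not> P dvd I ^ 3\<close>] by blast
  then have "(I * P) ^ 3 dvd N'\<^sup>2" by (simp add: u power_mult_distrib)
  then have "admissible A B (I * P) k"
    using IP IPA adm P(2) by (simp add: admissible_def N'_def cubic_at_def lead_coeff_mult)
  then have "degree (I * P) \<le> degree I" by (rule max_deg)
  then show False using P I_nz by (auto simp: degree_mult_eq)
qed

lemma norm_form_lattice: "norm_form A N (I * a - c * A) (I * b) c = I ^ 3 * lattice_norm I m n w a b c"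
  using n_square unfolding lattice_norm_def norm_form_def A_eq N_eq by Groebner_Basis.algebra


lemma local_maximality_if_not_dvd_m:
  assumes P: "prime_elem P" "degree P > 0" and m: "\<not> P dvd m"
    and T1: "P dvd m * c" and T2: "P\<^sup>2 dvd a * c * m - b\<^sup>2 * A" and T3: "P ^ 3 dvd lattice_norm I m n w a b c"
  shows "P dvd a \<and> P dvd b \<and> P dvd c"
proof -
  have nz: "P \<noteq> 0" using P by auto
  obtain c1 where c: "c = P * c1" using T1 m P(1) by (auto simp: prime_elem_dvd_mult_iff)
  obtain k l where k: "lattice_norm I m n w a b c = P ^ 3 * k" and l: "a * c * m - b\<^sup>2 * A = P\<^sup>2 * l"
    using T2 T3 by (auto elim!: dvdE)
  \<comment> \<open>Modulo \<open>P\<close> only the last summand survives, and it vanishes because \<open>P\<close> divides \<open>I\<close> or \<open>b\<close>.\<close>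
  have a3: "a ^ 3 = P * (P\<^sup>2 * k + m*a\<^sup>2*c1 - m*A*b\<^sup>2*c1 - n*m*b*P*c1\<^sup>2 - w*P\<^sup>2*c1^3) + I * (m*a*b\<^sup>2 + n*b^3)"
    using k unfolding lattice_norm_def c A_eq N_eq by Groebner_Basis.algebra
  show ?thesis
  proof (cases "P dvd I")
    case False
    have "(m * I) * b\<^sup>2 = P * (a * c1 * m - P * l)" using l unfolding c A_eq by Groebner_Basis.algebra
    then have "P dvd (m * I) * b\<^sup>2" by simp
    moreover have "\<not> P dvd m * I" using m False prime_elem_dvd_multD[OF P(1)] by blast
    ultimately have b: "P dvd b" by (rule prime_elem_dvd_mult_powerD[OF P(1)])
    then have "P dvd I * (m*a*b\<^sup>2 + n*b^3)" by (simp add: power2_eq_square power3_eq_cube)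
    then have "P dvd a ^ 3" unfolding a3 by simp
    then show ?thesis using b c prime_elem_dvd_power[OF P(1)] by auto
  next
    case True
    then obtain I1 where I1: "I = P * I1" by blast
    have nI1: "\<not> P dvd I1" using square_not_dvd_I[OF P] nz by (simp add: I1 power2_eq_square)
    have "P dvd a ^ 3" unfolding a3 using True by simp
    then obtain a1 where a: "a = P * a1" using prime_elem_dvd_power[OF P(1)] by blast
    have "P * ((m * I1) * b\<^sup>2) = P * (P * (a1 * c1 * m - l))" using l unfolding c a A_eq I1 by Groebner_Basis.algebra
    then have "(m * I1) * b\<^sup>2 = P * (a1 * c1 * m - l)" using nz by simp
    then have "P dvd (m * I1) * b\<^sup>2" by simp
    moreover have "\<not> P dvd m * I1" using m nI1 prime_elem_dvd_multD[OF P(1)] by blast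
    ultimately have "P dvd b" by (rule prime_elem_dvd_mult_powerD[OF P(1)])
    then show ?thesis using a c by simp
  qed
qed

text \<open>
  In terms of \<open>y - j\<close> instead of \<open>\<rho>\<close> the polynomial is Eisenstein at \<open>P\<close>. Passing to that basis
  multiplies by \<open>I\<close>, a unit at \<open>P\<close>.
\<close>

lemma local_maximality_away_from_I:
  assumes P: "prime_elem P" "lead_coeff P = 1" "degree P > 0" and m: "P dvd m" and I: "\<not> P dvd I"
    and T3: "P ^ 3 dvd lattice_norm I m n w a b c"
  shows "P dvd a \<and> P dvd b \<and> P dvd c"
proof -
  have A: "P dvd A" using m by (simp add: A_eq)
  obtain j where "P dvd j ^ 3 - (- B)" using exists_cube_mod_prime[OF three P(1)] by blast
  then have "P dvd j ^ 3 - (- B) - j * A" using A by (simp only: dvd_diff dvd_mult)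
  then have j: "P dvd cubic_at A B j" by (simp add: cubic_at_def algebra_simps)
  define e where "e = j - i"
  define a' where "a' = (I * a - c * A) + I * b * e + c * e\<^sup>2"
  define b' where "b' = I * b + 2 * c * e"
  have "cubic_at A B j = N + (j ^ 3 - i ^ 3) - e * A"
    unfolding N_def cubic_at_def e_def by Groebner_Basis.algebra
  then have Nj: "cubic_at A B j = N + e ^ 3 - e * A"
    unfolding e_def cube_diff[OF three_poly] by simp
  have "norm_form A (cubic_at A B j) a' b' c = I ^ 3 * lattice_norm I m n w a b c"
    unfolding Nj a'_def b'_def norm_form_shift[OF three_poly] by (rule norm_form_lattice)
  then have "P ^ 3 dvd norm_form A (cubic_at A B j) a' b' c" using T3 by simp
  then have abc: "P dvd a'" "P dvd b'" "P dvd c"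
    using prime_elem_Eisenstein_norm_form[OF P(1) A j square_not_dvd_cubic_at[OF P A I]] by blast+
  have "P dvd b' - c * (2 * e)" using abc by (intro dvd_diff dvd_mult2)
  then have "P dvd I * b" by (simp add: b'_def algebra_simps)
  then have b: "P dvd b" using P(1) I by (simp add: prime_elem_dvd_mult_iff)
  have "P dvd a' + c * (A - e\<^sup>2) - b * (I * e)" using abc b by (intro dvd_diff dvd_add dvd_mult2)
  then have "P dvd I * a" by (simp add: a'_def algebra_simps)
  then have "P dvd a" using P(1) I by (simp add: prime_elem_dvd_mult_iff)
  then show ?thesis using b abc by simp
qed

text \<open>
  Here \<open>n\<close> and \<open>w\<close> are divisible by \<open>P\<close> exactly once, so the three pure terms \<open>a\<^sup>3\<close>, \<open>w c\<^sup>3\<close>, \<open>N b\<^sup>3\<close> of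
  the norm form have valuations congruent to 0, 1, 2 modulo 3, and they are
  read off modulo \<open>P\<close>, \<open>P\<^sup>2\<close>, \<open>P\<^sup>3\<close> in this order.
\<close>

lemma local_maximality_at_I:
  assumes P: "prime_elem P" "degree P > 0" and m: "P dvd m" and I: "P dvd I"
    and T3: "P ^ 3 dvd lattice_norm I m n w a b c"
  shows "P dvd a \<and> P dvd b \<and> P dvd c"
proof -
  have nz: "P \<noteq> 0" using P by auto
  obtain I1 m1 where I1: "I = P * I1" and m1: "m = P * m1" using I m by (auto elim!: dvdE)
  have nI1: "\<not> P dvd I1" using square_not_dvd_I[OF P] nz by (simp add: I1 power2_eq_square)
  have "P dvd n\<^sup>2" using I by (simp add: n_square)
  then obtain n1 where n1: "n = P * n1" using prime_elem_dvd_power[OF P(1)] by blast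
  have "P\<^sup>2 dvd A" by (simp add: A_eq I1 m1 power2_eq_square mult_dvd_mono)
  then have "\<not> P ^ 3 dvd N" using not_both[OF P(2)] by (simp add: N_def)
  moreover have "N = P\<^sup>2 * (n1 * I1)" using N_eq n1 I1 by Groebner_Basis.algebra
  ultimately have nn1: "\<not> P dvd n1" using nz by (auto simp: power2_eq_square power3_eq_cube)
  have "P * (w * I1) = P * (P * n1\<^sup>2)" using n_square n1 I1 by Groebner_Basis.algebra
  then have w: "w * I1 = P * n1\<^sup>2" using nz by simp
  then have "P dvd w * I1" by simp
  then obtain w1 where w1: "w = P * w1" using nI1 P(1) by (auto simp: prime_elem_dvd_mult_iff)
  have "P * (w1 * I1) = P * n1\<^sup>2" using w w1 by Groebner_Basis.algebra
  then have "w1 * I1 = n1\<^sup>2" using nz by simp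
  then have nw1: "\<not> P dvd w1" using nn1 prime_elem_dvd_power[OF P(1)] by (metis dvd_mult2)
  obtain k where k: "lattice_norm I m n w a b c = P ^ 3 * k" using T3 by blast
  have "a ^ 3 = P * (P\<^sup>2*k + m1*a\<^sup>2*c + P*m1*I1*a*b\<^sup>2 - P\<^sup>2*m1\<^sup>2*I1*b\<^sup>2*c + P*n1*I1*b^3 - P*n1*m1*b*c\<^sup>2 - w1*c^3)"
    using k unfolding lattice_norm_def A_eq N_eq m1 n1 w1 I1 by Groebner_Basis.algebra
  then have "P dvd a ^ 3" by simp
  then obtain a1 where a: "a = P * a1" using prime_elem_dvd_power[OF P(1)] by blast
  have "P * (w1 * c ^ 3) = P * (P * (P*k - P*a1^3 + P*m1*a1\<^sup>2*c + P*m1*I1*a1*b\<^sup>2 - P*m1\<^sup>2*I1*b\<^sup>2*c + n1*I1*b^3 - n1*m1*b*c\<^sup>2))"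
    using k unfolding lattice_norm_def A_eq N_eq m1 n1 w1 I1 a by Groebner_Basis.algebra
  then have "w1 * c ^ 3 = P * (P*k - P*a1^3 + P*m1*a1\<^sup>2*c + P*m1*I1*a1*b\<^sup>2 - P*m1\<^sup>2*I1*b\<^sup>2*c + n1*I1*b^3 - n1*m1*b*c\<^sup>2)"
    using nz by simp
  then have "P dvd w1 * c ^ 3" by simp
  then obtain c1 where c: "c = P * c1" using prime_elem_dvd_mult_powerD[OF P(1)] nw1 by blast
  have "P\<^sup>2 * (n1 * I1 * b ^ 3) = P\<^sup>2 * (P * (- k + a1^3 - P*m1*a1\<^sup>2*c1 - m1*I1*a1*b\<^sup>2 + P*m1\<^sup>2*I1*b\<^sup>2*c1 + P*n1*m1*b*c1\<^sup>2 + P*w1*c1^3))"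
    using k unfolding lattice_norm_def A_eq N_eq m1 n1 w1 I1 a c by Groebner_Basis.algebra
  then have "n1 * I1 * b ^ 3 = P * (- k + a1^3 - P*m1*a1\<^sup>2*c1 - m1*I1*a1*b\<^sup>2 + P*m1\<^sup>2*I1*b\<^sup>2*c1 + P*n1*m1*b*c1\<^sup>2 + P*w1*c1^3)"
    using nz by simp
  then have "P dvd n1 * I1 * b ^ 3" by simp
  moreover have "\<not> P dvd n1 * I1" using nn1 nI1 prime_elem_dvd_multD[OF P(1)] by blast
  ultimately have "P dvd b" by (rule prime_elem_dvd_mult_powerD[OF P(1)])
  then show ?thesis using a c by simp
qed

text \<open>
  The hypotheses say that the characteristic polynomial of \<open>(a + b \<rho> + c \<omega>) / d\<close> has polynomial
  coefficients. They are homogeneous, so the primes of \<open>d\<close> can be removed one after the other.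
\<close>

lemma denominator_dvd:
  assumes "d \<noteq> 0" "d dvd m * c" "d\<^sup>2 dvd a * c * m - b\<^sup>2 * A" "d ^ 3 dvd lattice_norm I m n w a b c"
  shows "d dvd a \<and> d dvd b \<and> d dvd c"
  using assms
proof (induction "degree d" arbitrary: d a b c rule: less_induct)
  case less
  show ?case
  proof (cases "degree d = 0")
    case True
    then have "d dvd 1" using less.prems(1) is_unit_iff_degree by blast
    then show ?thesis by (meson dvd_trans one_dvd)
  next
    case False
    then have "degree d > 0" by simp
    then obtain P where P: "lead_coeff P = 1" "degree P > 0" "prime_elem P" "P dvd d"
      by (rule exists_monic_prime_factor)
    have nz: "P \<noteq> 0" using P by auto
    have Pd: "P dvd m * c" "P\<^sup>2 dvd a * c * m - b\<^sup>2 * A" "P ^ 3 dvd lattice_norm I m n w a b c"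
      using P(4) less.prems by (meson dvd_trans dvd_power_same)+
    have "P dvd a \<and> P dvd b \<and> P dvd c"
      using local_maximality_if_not_dvd_m[OF P(3,2) _ Pd] local_maximality_away_from_I[OF P(3,1,2) _ _ Pd(3)]
        local_maximality_at_I[OF P(3,2) _ _ Pd(3)] by blast
    then obtain a1 b1 c1 d1 where eqs: "a = P * a1" "b = P * b1" "c = P * c1" "d = P * d1"
      using P(4) by (auto elim!: dvdE)
    have "P * d1 dvd P * (m * c1)" using less.prems(2) by (simp add: eqs ac_simps)
    then have 1: "d1 dvd m * c1" using nz by simp
    have "a * c * m - b\<^sup>2 * A = P\<^sup>2 * (a1 * c1 * m - b1\<^sup>2 * A)" unfolding eqs by Groebner_Basis.algebra
    then have "P\<^sup>2 * d1\<^sup>2 dvd P\<^sup>2 * (a1 * c1 * m - b1\<^sup>2 * A)"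
      using less.prems(3) by (simp add: eqs(4) power_mult_distrib)
    then have 2: "d1\<^sup>2 dvd a1 * c1 * m - b1\<^sup>2 * A" using nz by simp
    have "lattice_norm I m n w a b c = P ^ 3 * lattice_norm I m n w a1 b1 c1" unfolding eqs lattice_norm_def by Groebner_Basis.algebra
    then have "P ^ 3 * d1 ^ 3 dvd P ^ 3 * lattice_norm I m n w a1 b1 c1"
      using less.prems(4) by (simp add: eqs(4) power_mult_distrib)
    then have 3: "d1 ^ 3 dvd lattice_norm I m n w a1 b1 c1" using nz by simp
    have "d1 \<noteq> 0" "degree d1 < degree d" using eqs less.prems(1) P(2) by (auto simp: degree_mult_eq)
    then have "d1 dvd a1 \<and> d1 dvd b1 \<and> d1 dvd c1" using less.hyps 1 2 3 by blast
    then show ?thesis by (simp add: eqs)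
  qed
qed

end

section \<open>The cubic extension and its conjugates\<close>

lemma map_poly_to_ac_mult: "map_poly to_ac (p * q) = map_poly to_ac p * map_poly to_ac q"
  by (intro poly_eqI) (simp add: coeff_map_poly coeff_mult to_ac_sum)

lemma map_poly_to_ac_add: "map_poly to_ac (p + q) = map_poly to_ac p + map_poly to_ac q"
  by (intro poly_eqI) (simp add: coeff_map_poly)

text \<open>
  Division with remainder is compatible with the field extension, and degrees are preserved.
\<close>

lemma dvd_if_map_poly_to_ac_dvd:
  assumes "map_poly to_ac p dvd map_poly to_ac q"
  shows "p dvd (q :: 'k::field poly)"
proof (cases "p = 0")
  case True
  then show ?thesis using assms by (simp add: map_poly_eq_0_iff)
next
  case False
  have "map_poly to_ac q = map_poly to_ac p * map_poly to_ac (q div p) + map_poly to_ac (q mod p)"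
    by (simp flip: map_poly_to_ac_mult map_poly_to_ac_add)
  then have dvd: "map_poly to_ac p dvd map_poly to_ac (q mod p)"
    using assms by (simp add: dvd_add_right_iff)
  have "q mod p = 0"
  proof (rule ccontr)
    assume nz: "q mod p \<noteq> 0"
    then have "map_poly to_ac (q mod p) \<noteq> 0" by (simp add: map_poly_eq_0_iff)
    then have "degree (map_poly to_ac p) \<le> degree (map_poly to_ac (q mod p))"
      by (rule dvd_imp_degree_le[OF dvd])
    then show False using degree_mod_less'[OF False nz] by (simp add: degree_map_poly)
  qed
  then show ?thesis by (simp add: mod_eq_0_iff_dvd)
qed

definition quad :: "'k::field alg_closure \<Rightarrow> 'k \<Rightarrow> 'k \<Rightarrow> 'k \<Rightarrow> 'k alg_closure" where
  "quad x a b c = to_ac a + to_ac b * x + to_ac c * x\<^sup>2"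

definition quads :: "'k::field alg_closure \<Rightarrow> 'k alg_closure set" where
  "quads x = {quad x a b c | a b c. True}"

lemma quadI [intro]: "quad x a b c \<in> quads x"
  by (auto simp: quads_def)

lemma quadsE: assumes "z \<in> quads x" obtains a b c where "z = quad x a b c"
  using assms by (auto simp: quads_def)

lemma quad_const [simp]: "quad x a 0 0 = to_ac a"
  and quad_gen [simp]: "quad x 0 1 0 = x"
  by (simp_all add: quad_def)

lemma quad_add: "quad x a b c + quad x a' b' c' = quad x (a + a') (b + b') (c + c')"
  by (simp add: quad_def algebra_simps)

lemma quad_uminus: "- quad x a b c = quad x (- a) (- b) (- c)"
  by (simp add: quad_def)

text \<open>
  A cubic without a root in the base field is irreducible, and \<open>g \<noteq> 0\<close> makes this one separable.
\<close>

locale depressed_cubic =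
  fixes g h :: "'k::field" and t :: "'k alg_closure"
  assumes three: "(3::'k) = 0" and g_nz: "g \<noteq> 0"
    and no_root: "\<And>r. r ^ 3 - g * r + h \<noteq> 0"
    and root: "t ^ 3 - to_ac g * t + to_ac h = 0"
begin

definition is_root :: "'k alg_closure \<Rightarrow> bool" where
  "is_root x \<longleftrightarrow> x ^ 3 - to_ac g * x + to_ac h = 0"

lemma three_ac: "(3 :: 'k alg_closure) = 0"
  using three by (metis to_ac_0 to_ac_numeral)

lemma root_not_in_base: "is_root x \<Longrightarrow> x \<noteq> to_ac r"
proof
  assume "is_root x" "x = to_ac r"
  then have "to_ac (r ^ 3 - g * r + h) = 0" by (simp add: is_root_def)
  then show False using no_root by (metis to_ac_eq_0_iff)
qed

lemma linear_root_eq_0: "is_root x \<Longrightarrow> to_ac a + to_ac b * x = 0 \<Longrightarrow> a = 0 \<and> b = 0"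
proof -
  assume x: "is_root x" and eq: "to_ac a + to_ac b * x = 0"
  have "b = 0"
  proof (rule ccontr)
    assume "b \<noteq> 0"
    then have "x = to_ac (- a / b)" using eq by (simp add: field_simps add_eq_0_iff)
    then show False using root_not_in_base[OF x] by blast
  qed
  then show ?thesis using eq by simp
qed

text \<open>
  If a root \<open>x\<close> satisfied \<open>x\<^sup>2 + q x + p = 0\<close> over the base field, division of the cubic by this quadratic
  would leave remainder zero and the linear quotient would exhibit \<open>q\<close> as a root in the base field.
\<close>

lemma quad_eq_0_iff:
  assumes x: "is_root x"
  shows "quad x a b c = 0 \<longleftrightarrow> a = 0 \<and> b = 0 \<and> c = 0"
proof
  assume eq: "quad x a b c = 0"
  have "c = 0"
  proof (rule ccontr)
    assume c: "c \<noteq> 0"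
    define p q where "p = a / c" and "q = b / c"
    have "a = p * c" "b = q * c" using c by (simp_all add: p_def q_def)
    then have "to_ac c * (x\<^sup>2 + to_ac q * x + to_ac p) = 0"
      using eq by (simp add: quad_def algebra_simps)
    then have "x\<^sup>2 + to_ac q * x + to_ac p = 0" using c by simp
    then have "to_ac (q * p + h) + to_ac (q\<^sup>2 - p - g) * x = 0"
      using x unfolding is_root_def to_ac_add to_ac_diff to_ac_mult to_ac_power by Groebner_Basis.algebra
    then have "q * p + h = 0" "q\<^sup>2 - p - g = 0" using linear_root_eq_0[OF x] by blast+
    then have "q ^ 3 - g * q + h = 0" by Groebner_Basis.algebra
    then show False using no_root by blast
  qed
  then show "a = 0 \<and> b = 0 \<and> c = 0" using eq linear_root_eq_0[OF x] by (simp add: quad_def)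
qed (simp add: quad_def)

lemma quad_eq_iff:
  assumes "is_root x"
  shows "quad x a b c = quad x a' b' c' \<longleftrightarrow> a = a' \<and> b = b' \<and> c = c'"
proof -
  have "quad x a b c = quad x a' b' c' \<longleftrightarrow> quad x (a - a') (b - b') (c - c') = 0"
    by (simp add: quad_def algebra_simps)
  then show ?thesis using quad_eq_0_iff[OF assms] by simp
qed

lemma quad_mult:
  assumes "is_root x"
  shows "quad x a b c * quad x a' b' c' =
    quad x (a * a' - h * (b * c' + c * b')) (a * b' + b * a' + g * (b * c' + c * b') - h * c * c')
      (a * c' + b * b' + c * a' + g * c * c')"
  using assms unfolding is_root_def quad_def to_ac_add to_ac_diff to_ac_mult by Groebner_Basis.algebra

definition s :: "'k alg_closure" where "s = (SOME s. s\<^sup>2 = to_ac g)"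

lemma s_square: "s\<^sup>2 = to_ac g"
  unfolding s_def using nth_root_exists[of 2 "to_ac g"] by (rule someI_ex) simp

lemma s_nz: "s \<noteq> 0"
  using s_square g_nz by auto

lemma root_t: "is_root t"
  using root by (simp add: is_root_def)

lemma is_root_add_s:
  assumes "is_root x"
  shows "is_root (x + s)" "is_root (x - s)"
proof -
  have "s ^ 3 = to_ac g * s" using s_square by (simp add: power3_eq_cube power2_eq_square)
  then show "is_root (x + s)" "is_root (x - s)"
    using assms unfolding is_root_def cube_add[OF three_ac] cube_diff[OF three_ac]
    by (simp_all add: algebra_simps)
qed

text \<open>
  The difference of two roots satisfies \<open>u\<^sup>3 = g u\<close>, because cubing is additive.
\<close>

lemma is_root_iff: "is_root x \<longleftrightarrow> x = t \<or> x = t + s \<or> x = t - s"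
proof
  assume "is_root x"
  then have "(x - t) ^ 3 = to_ac g * (x - t)"
    using root unfolding is_root_def cube_diff[OF three_ac] by Groebner_Basis.algebra
  then have "(x - t) * ((x - t) - s) * ((x - t) + s) = 0"
    using s_square by Groebner_Basis.algebra
  then consider "x - t = 0" | "x - t - s = 0" | "x - t + s = 0"
    unfolding mult_eq_0_iff by blast
  then show "x = t \<or> x = t + s \<or> x = t - s"
    by cases (simp_all add: algebra_simps)
qed (use root_t is_root_add_s in auto)

definition sigma1 :: "'k \<Rightarrow> 'k" where "sigma1 c = 2 * g * c"
definition sigma2 :: "'k \<Rightarrow> 'k \<Rightarrow> 'k \<Rightarrow> 'k" where
  "sigma2 a b c = a * c * g - b\<^sup>2 * g + c\<^sup>2 * g\<^sup>2"

text \<open>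
  The identities hold over the integers up to three times the polynomials given in the proof.
\<close>

lemma conjugates_symmetric:
  shows "quad t a b c + quad (t + s) a b c + quad (t - s) a b c = to_ac (sigma1 c)" (is ?T)
    and "quad t a b c * quad (t + s) a b c + quad t a b c * quad (t - s) a b c
           + quad (t + s) a b c * quad (t - s) a b c = to_ac (sigma2 a b c)" (is ?S)
    and "quad t a b c * quad (t + s) a b c * quad (t - s) a b c = to_ac (norm_form g h a b c)" (is ?N)
proof -
  define a1 b1 c1 g1 h1 where defs: "a1 = to_ac a" "b1 = to_ac b" "c1 = to_ac c" "g1 = to_ac g" "h1 = to_ac h"
  have s2: "g1 = s\<^sup>2" using s_square by (simp add: defs)
  have h1: "h1 = s\<^sup>2 * t - t ^ 3" using root unfolding s2[symmetric] by (simp add: defs algebra_simps)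
  have "quad t a b c + quad (t + s) a b c + quad (t - s) a b c =
      to_ac (sigma1 c) + 3 * (a1 + b1*t + c1*t\<^sup>2)"
    unfolding quad_def sigma1_def to_ac_mult to_ac_numeral defs[symmetric] s2
    by (simp add: algebra_simps power2_eq_square)
  then show ?T by (simp add: three_ac)
  have "quad t a b c * quad (t + s) a b c + quad t a b c * quad (t - s) a b c
      + quad (t + s) a b c * quad (t - s) a b c =
      to_ac (sigma2 a b c) + 3 * (a1^2 + 2*a1*b1*t + 2*a1*c1*t^2 + g1*a1*c1 + b1^2*t^2 + 2*g1*b1*c1*t
        - 2*h1*b1*c1 + g1*c1^2*t^2 - h1*c1^2*t)"
    unfolding quad_def sigma2_def to_ac_add to_ac_diff to_ac_mult to_ac_power to_ac_numeral defs[symmetric] s2 h1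
    by Groebner_Basis.algebra
  then show ?S by (simp add: three_ac)
  have "quad t a b c * quad (t + s) a b c * quad (t - s) a b c =
      to_ac (norm_form g h a b c) + 3 * (a1^2*b1*t + a1^2*c1*t^2 + a1*b1^2*t^2 + 2*g1*a1*b1*c1*t
        - 2*h1*a1*b1*c1 + g1*a1*c1^2*t^2 - h1*a1*c1^2*t - h1*b1^2*c1*t - h1*b1*c1^2*t^2)"
    unfolding quad_def norm_form_def to_ac_add to_ac_diff to_ac_mult to_ac_power to_ac_numeral defs[symmetric] s2 h1
    by Groebner_Basis.algebra
  then show ?N by (simp add: three_ac)
qed

definition char_poly :: "'k \<Rightarrow> 'k \<Rightarrow> 'k \<Rightarrow> 'k poly" where
  "char_poly a b c = [:- norm_form g h a b c, sigma2 a b c, - sigma1 c, 1:]"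

lemma char_poly_splits:
  "map_poly to_ac (char_poly a b c) =
     [:- quad t a b c, 1:] * [:- quad (t + s) a b c, 1:] * [:- quad (t - s) a b c, 1:]"
proof -
  have "[:- u, 1:] * [:- v, 1:] * [:- w, 1:] = [:- (u * v * w), u * v + u * w + v * w, - (u + v + w), 1:]"
    for u v w :: "'k alg_closure"
    by (simp add: algebra_simps)
  then show ?thesis
    unfolding char_poly_def by (simp only: conjugates_symmetric) (simp add: map_poly_pCons)
qed

lemma char_poly_root: "poly (map_poly to_ac (char_poly a b c)) (quad t a b c) = 0"
  unfolding char_poly_splits poly_mult by simp

text \<open>
  All conjugates of a nonzero element are nonzero, by linear independence at each of the roots.
\<close>

lemma norm_form_nz:
  assumes "quad t a b c \<noteq> 0"
  shows "norm_form g h a b c \<noteq> 0"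
proof -
  have "quad x a b c \<noteq> 0" if "is_root x" for x
    using assms quad_eq_0_iff[OF that] quad_eq_0_iff[OF root_t] by blast
  then have "quad t a b c * quad (t + s) a b c * quad (t - s) a b c \<noteq> 0"
    using is_root_iff by simp
  then show ?thesis unfolding conjugates_symmetric(3) by simp
qed

lemma quads_add: "z \<in> quads t \<Longrightarrow> z' \<in> quads t \<Longrightarrow> z + z' \<in> quads t"
  by (elim quadsE) (auto simp: quad_add)

lemma quads_uminus: "z \<in> quads t \<Longrightarrow> - z \<in> quads t"
  by (elim quadsE) (auto simp: quad_uminus)

lemma quads_mult: "z \<in> quads t \<Longrightarrow> z' \<in> quads t \<Longrightarrow> z * z' \<in> quads t"
  by (elim quadsE) (auto simp: quad_mult[OF root_t])

lemma to_ac_in_quads: "to_ac r \<in> quads t"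
  by (metis quadI quad_const)

lemma t_in_quads: "t \<in> quads t"
  by (metis quadI quad_gen)

lemma quads_inverse:
  assumes "z \<in> quads t"
  shows "inverse z \<in> quads t"
proof (cases "z = 0")
  case False
  obtain a b c where z: "z = quad t a b c" using assms by (rule quadsE)
  define r where "r = norm_form g h a b c"
  have r: "r \<noteq> 0" using False norm_form_nz by (simp add: z r_def)
  have "z * (z * z + - to_ac (sigma1 c) * z + to_ac (sigma2 a b c)) = to_ac r"
    using char_poly_root[of a b c]
    by (simp add: char_poly_def map_poly_pCons z r_def algebra_simps)
  moreover have "to_ac (inverse r) * to_ac r = 1" using r by simp
  ultimately have "z * (to_ac (inverse r) * (z * z + - to_ac (sigma1 c) * z + to_ac (sigma2 a b c))) = 1"
    by (metis mult.left_commute)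
  then have eq: "inverse z = to_ac (inverse r) * (z * z + - to_ac (sigma1 c) * z + to_ac (sigma2 a b c))"
    by (rule inverse_unique)
  show ?thesis
    unfolding eq by (intro quads_mult quads_add quads_uminus to_ac_in_quads assms)
qed (use to_ac_in_quads[of 0] in simp)

text \<open>
  The embedding that sends \<open>t\<close> to \<open>x\<close>. It is undefined outside the field, as the extensionality
  condition in \<open>embeddings\<close> requires.
\<close>

definition conj_map :: "'k alg_closure \<Rightarrow> 'k alg_closure \<Rightarrow> 'k alg_closure" where
  "conj_map x = restrict (\<lambda>z. THE w. \<exists>a b c. z = quad t a b c \<and> w = quad x a b c) (quads t)"

lemma conj_map_quad: "conj_map x (quad t a b c) = quad x a b c"
proof -
  have "(THE w. \<exists>a' b' c'. quad t a b c = quad t a' b' c' \<and> w = quad x a' b' c') = quad x a b c"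
    by (rule the_equality) (auto simp: quad_eq_iff[OF root_t])
  then show ?thesis by (simp add: conj_map_def quadI)
qed

definition root_of :: "3 \<Rightarrow> 'k alg_closure" where
  "root_of j = (if j = 1 then t else if j = 2 then t + s else t - s)"

text \<open>
  Evaluating a polynomial over the base field commutes with passing to a conjugate; stating
  it with coordinates common to all roots avoids the embeddings.
\<close>

lemma poly_at_conjugates:
  "\<exists>a' b' c'. \<forall>x. is_root x \<longrightarrow> poly (map_poly to_ac p) (quad x a b c) = quad x a' b' c'"
proof (induction p)
  case 0
  show ?case by (rule exI[of _ 0], rule exI[of _ 0], rule exI[of _ 0]) (simp add: quad_def)
next
  case (pCons r p)
  then obtain a' b' c' where IH: "\<And>x. is_root x \<Longrightarrow> poly (map_poly to_ac p) (quad x a b c) = quad x a' b' c'"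
    by blast
  have "poly (map_poly to_ac (pCons r p)) (quad x a b c) =
      quad x r 0 0 + quad x a b c * quad x a' b' c'" if "is_root x" for x
    using IH[OF that] by (simp add: map_poly_pCons)
  then have "poly (map_poly to_ac (pCons r p)) (quad x a b c) =
      quad x (r + (a * a' - h * (b * c' + c * b')))
        (0 + (a * b' + b * a' + g * (b * c' + c * b') - h * c * c'))
        (0 + (a * c' + b * b' + c * a' + g * c * c'))" if "is_root x" for x
    using that by (simp only: quad_mult[OF that] quad_add)
  then show ?case by blast
qed

text \<open>
  Each conjugate is a root of \<open>p\<close>. The conjugates may coincide (for elements of the base field), whence the cube.
\<close>

lemma char_poly_dvd_cube:
  assumes "poly (map_poly to_ac p) (quad t a b c) = 0"
  shows "char_poly a b c dvd p ^ 3"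
proof (rule dvd_if_map_poly_to_ac_dvd)
  obtain a' b' c' where eq: "\<And>x. is_root x \<Longrightarrow> poly (map_poly to_ac p) (quad x a b c) = quad x a' b' c'"
    using poly_at_conjugates by blast
  then have "a' = 0 \<and> b' = 0 \<and> c' = 0" using assms quad_eq_0_iff root_t by metis
  then have "poly (map_poly to_ac p) (quad x a b c) = 0" if "is_root x" for x
    using eq[OF that] by simp
  then have "[:- quad x a b c, 1:] dvd map_poly to_ac p" if "is_root x" for x
    using that by (simp add: poly_eq_0_iff_dvd)
  then have "[:- quad t a b c, 1:] * [:- quad (t + s) a b c, 1:] * [:- quad (t - s) a b c, 1:]
      dvd map_poly to_ac p * map_poly to_ac p * map_poly to_ac p"
    using is_root_iff by (intro mult_dvd_mono) auto
  then show "map_poly to_ac (char_poly a b c) dvd map_poly to_ac (p ^ 3)"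
    unfolding char_poly_splits by (simp add: power3_eq_cube map_poly_to_ac_mult mult.assoc)
qed

end

lemma depressed_cubic_shift:
  assumes "depressed_cubic g h t"
  shows "depressed_cubic g (e ^ 3 - e * g + h) (t - to_ac e)"
proof -
  interpret depressed_cubic g h t by fact
  show ?thesis
  proof
    show "(3::'a) = 0" "g \<noteq> 0" by (fact three g_nz)+
    fix r :: 'a
    have "r ^ 3 - g * r + (e ^ 3 - e * g + h) = (r + e) ^ 3 - g * (r + e) + h"
      by (simp add: cube_add[OF three] algebra_simps)
    then show "r ^ 3 - g * r + (e ^ 3 - e * g + h) \<noteq> 0" using no_root by metis
  next
    show "(t - to_ac e) ^ 3 - to_ac g * (t - to_ac e) + to_ac (e ^ 3 - e * g + h) = 0"
      using root by (simp add: cube_diff[OF three_ac] algebra_simps)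
  qed
qed

lemma quad_shift: "quad (t - to_ac e) a b c = quad t (a - b * e + c * e\<^sup>2) (b - 2 * c * e) c"
  unfolding quad_def to_ac_add to_ac_diff to_ac_mult to_ac_power to_ac_numeral
  by Groebner_Basis.algebra

lemma quad_shift': "quad t a b c = quad (t - to_ac e) (a + b * e + c * e\<^sup>2) (b + 2 * c * e) c"
  unfolding quad_def to_ac_add to_ac_diff to_ac_mult to_ac_power to_ac_numeral
  by Groebner_Basis.algebra

lemma quads_shift: "quads (t - to_ac e) = quads t"
  by (auto elim!: quadsE simp: quad_shift) (metis quadI quad_shift')

section \<open>Cubic extensions of the rational function field\<close>

lemma ring_of_type_algebra_simps [simp]:
  "carrier ring_of_type_algebra = UNIV"
  "x \<otimes>\<^bsub>ring_of_type_algebra\<^esub> y = x * y"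
  "x \<oplus>\<^bsub>ring_of_type_algebra\<^esub> y = x + y"
  "\<one>\<^bsub>ring_of_type_algebra\<^esub> = 1"
  "\<zero>\<^bsub>ring_of_type_algebra\<^esub> = 0"
  by (simp_all add: ring_of_type_algebra_def)

lemma a_inv_ring_of_type_algebra [simp]: "\<ominus>\<^bsub>ring_of_type_algebra\<^esub> x = - (x :: 'k::field)"
proof -
  interpret Ring.field "ring_of_type_algebra :: 'k ring" by (rule field_from_type_algebra)
  show ?thesis by (rule minus_equality) simp_all
qed

lemma m_inv_ring_of_type_algebra:
  assumes "x \<noteq> 0"
  shows "inv\<^bsub>ring_of_type_algebra\<^esub> x = inverse (x :: 'k::field)"
proof -
  interpret Ring.field "ring_of_type_algebra :: 'k ring" by (rule field_from_type_algebra)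
  show ?thesis using assms by (intro comm_inv_char) simp_all
qed

lemma of_base_eq: "of_base p = to_ac (to_fract p)"
  by (simp add: of_base_def to_fract_def)

lemma of_base_simps [simp]:
  "of_base 0 = 0" "of_base 1 = 1" "of_base (p + q) = of_base p + of_base q"
  "of_base (p - q) = of_base p - of_base q" "of_base (- p) = - of_base p"
  "of_base (p * q) = of_base p * of_base q" "of_base p = 0 \<longleftrightarrow> p = 0"
  by (simp_all add: of_base_eq)

lemma to_fract_power [simp]: "to_fract (p ^ k) = to_fract p ^ k"
  by (induction k) simp_all

lemma map_poly_of_base: "map_poly of_base p = map_poly to_ac (map_poly to_fract p)"
  by (intro poly_eqI) (simp add: coeff_map_poly of_base_eq)

lemma common_denominator:
  fixes x y z :: "'a::idom fract"
  obtains d p q r where "d \<noteq> 0" "to_fract d * x = to_fract p" "to_fract d * y = to_fract q" "to_fract d * z = to_fract r"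
proof -
  obtain p1 q1 where x: "x = Fract p1 q1" "q1 \<noteq> 0" by (cases x) auto
  obtain p2 q2 where y: "y = Fract p2 q2" "q2 \<noteq> 0" by (cases y) auto
  obtain p3 q3 where z: "z = Fract p3 q3" "q3 \<noteq> 0" by (cases z) auto
  show thesis
  proof (rule that)
    show "q1 * q2 * q3 \<noteq> 0" using x y z by simp
    show "to_fract (q1 * q2 * q3) * x = to_fract (p1 * q2 * q3)"
      "to_fract (q1 * q2 * q3) * y = to_fract (q1 * p2 * q3)"
      "to_fract (q1 * q2 * q3) * z = to_fract (q1 * q2 * p3)"
      using x y z by (simp_all add: Fract_conv_to_fract)
  qed
qed

text \<open>
  A root in the field of fractions is a polynomial \<open>r0\<close> by Gauss's lemma, and then \<open>T - r0\<close> splits off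
  even over the algebraic closure of the constants.
\<close>

lemma absolutely_irreducible_cubic_no_root:
  fixes A B :: "'a::field poly"
  assumes "absolutely_irreducible (cubic A B)"
  shows "r ^ 3 - to_fract A * r + to_fract B \<noteq> 0"
proof
  assume "r ^ 3 - to_fract A * r + to_fract B = 0"
  then have "poly (map_poly to_fract (cubic A B)) r = 0"
    by (simp add: cubic_def map_poly_pCons algebra_simps power3_eq_cube)
  then obtain H where "map_poly to_fract (cubic A B) = [:- r, 1:] * H"
    by (metis dvdE poly_eq_0_iff_dvd)
  then obtain G where "[:- r, 1:] = map_poly to_fract G"
    using monic_factor_of_integral_poly[of "[:- r, 1:]" H "cubic A B"] by (auto simp: cubic_def)
  then have "coeff [:- r, 1:] 0 = coeff (map_poly to_fract G) 0" by simp
  then have r: "r = to_fract (- coeff G 0)" by (simp add: coeff_map_poly) (metis add.inverse_inverse)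
  define r0 where "r0 = - coeff G 0"
  have "to_fract (r0 ^ 3 - A * r0 + B) = 0"
    using \<open>r ^ 3 - to_fract A * r + to_fract B = 0\<close> r by (simp add: r0_def)
  then have "r0 ^ 3 - A * r0 + B = 0" by (simp only: to_fract_eq_0_iff)
  define u where "u = r0 * r0 - A"
  have A: "- A = u - r0 * r0" by (simp add: u_def)
  have B: "B = - (r0 * u)"
    using \<open>r0 ^ 3 - A * r0 + B = 0\<close> unfolding u_def by Groebner_Basis.algebra
  let ?m = "map_poly (to_ac :: 'a \<Rightarrow> 'a alg_closure)"
  have uminus: "?m (- p) = - ?m p" and diff: "?m (p - q) = ?m p - ?m q" for p q
    by (intro poly_eqI; simp add: coeff_map_poly)+
  have "?m B = - (?m r0 * ?m u)" "?m (- A) = ?m u - ?m r0 * ?m r0"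
    unfolding A unfolding B by (simp_all only: uminus diff map_poly_to_ac_mult)
  then have "map_poly ?m (cubic A B) = map_poly ?m [:- r0, 1:] * map_poly ?m [:u, r0, 1:]"
    unfolding cubic_def by (simp add: map_poly_pCons uminus algebra_simps)
  then have "map_poly ?m [:- r0, 1:] dvd 1 \<or> map_poly ?m [:u, r0, 1:] dvd 1"
    using assms unfolding absolutely_irreducible_def by (simp add: irreducibleD)
  then show False by (auto simp: map_poly_pCons is_unit_poly_iff)
qed

locale function_field_cubic = depressed_cubic g h t
  for g h :: "'a::field poly fract" and t :: "'a ratfun_closure"
begin

lemma adjoin_eq_quads: "adjoin t = quads t"
proof
  show "adjoin t \<subseteq> quads t"
  proof
    fix z assume "z \<in> adjoin t"
    then show "z \<in> quads t" unfolding adjoin_def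
    proof (induction rule: generate_field.induct)
      case one
      then show ?case using to_ac_in_quads[of 1] by simp
    next
      case (incl z)
      then show ?case using t_in_quads to_ac_in_quads by auto
    next
      case (a_inv z)
      then show ?case by (simp add: quads_uminus)
    next
      case (m_inv z)
      then show ?case by (simp add: m_inv_ring_of_type_algebra quads_inverse)
    next
      case (eng_add z z')
      then show ?case by (simp add: quads_add)
    next
      case (eng_mult z z')
      then show ?case by (simp add: quads_mult)
    qed
  qed
next
  let ?R = "ring_of_type_algebra :: 'a ratfun_closure ring"
  have mult: "x * y \<in> adjoin t" if "x \<in> adjoin t" "y \<in> adjoin t" for x y
    using generate_field.eng_mult[of x ?R _ y] that by (simp add: adjoin_def)
  have add: "x + y \<in> adjoin t" if "x \<in> adjoin t" "y \<in> adjoin t" for x y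
    using generate_field.eng_add[of x ?R _ y] that by (simp add: adjoin_def)
  have "t \<in> adjoin t" "to_ac r \<in> adjoin t" for r
    unfolding adjoin_def by (auto intro: generate_field.incl)
  then show "quads t \<subseteq> adjoin t"
    by (auto simp: quads_def quad_def power2_eq_square intro!: add mult)
qed

lemma root_of_root: "is_root (root_of j)"
  by (simp add: is_root_iff root_of_def)

lemma inj_root_of: "inj root_of"
proof -
  have ne: "t + s \<noteq> t - s"
  proof
    assume "t + s = t - s"
    then have "3 * s = s" by Groebner_Basis.algebra
    then show False using s_nz three_ac by simp
  qed
  have ne': "t \<noteq> t + s" "t \<noteq> t - s" using s_nz by simp_all
  have root_of: "root_of 1 = t" "root_of 2 = t + s" "root_of 3 = t - s" by (simp_all add: root_of_def)
  show ?thesis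
  proof (rule injI)
    fix j k :: 3
    assume eq: "root_of j = root_of k"
    consider "j = 1" | "j = 2" | "j = 3" using exhaust_3 by blast
    then show "j = k"
    proof cases
      case 1
      then show ?thesis using eq exhaust_3[of k] ne' by (elim disjE) (simp_all only: root_of)
    next
      case 2
      then show ?thesis using eq exhaust_3[of k] ne ne'(1)[symmetric] by (elim disjE) (simp_all only: root_of)
    next
      case 3
      then show ?thesis using eq exhaust_3[of k] ne[symmetric] ne'(2)[symmetric] by (elim disjE) (simp_all only: root_of)
    qed
  qed
qed

lemma conj_map_embedding:
  assumes "is_root x"
  shows "conj_map x \<in> embeddings (quads t)"
proof -
  have "conj_map x (to_ac r) = to_ac r" for r
    using conj_map_quad[of x r 0 0] by simp
  moreover have "conj_map x (z + z') = conj_map x z + conj_map x z'"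
    "conj_map x (z * z') = conj_map x z * conj_map x z'" if "z \<in> quads t" "z' \<in> quads t" for z z'
    using that by (auto elim!: quadsE simp: conj_map_quad quad_add quad_mult root_t assms)
  moreover have "conj_map x 1 = 1" using calculation(1)[of 1] by simp
  ultimately show ?thesis
    by (simp add: embeddings_def ring_hom_def conj_map_def)
qed

lemma embedding_eq_conj_map:
  assumes "\<sigma> \<in> embeddings (quads t)"
  shows "is_root (\<sigma> t)" "\<sigma> = conj_map (\<sigma> t)"
proof -
  have \<sigma>: "\<sigma> \<in> extensional (quads t)" "\<And>r. \<sigma> (to_ac r) = to_ac r"
    "\<And>z z'. z \<in> quads t \<Longrightarrow> z' \<in> quads t \<Longrightarrow> \<sigma> (z + z') = \<sigma> z + \<sigma> z'"
    "\<And>z z'. z \<in> quads t \<Longrightarrow> z' \<in> quads t \<Longrightarrow> \<sigma> (z * z') = \<sigma> z * \<sigma> z'"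
    using assms by (auto simp: embeddings_def ring_hom_def)
  note closed = quads_add quads_mult quads_uminus to_ac_in_quads t_in_quads
  have "t * t * t + to_ac (- g) * t + to_ac h = 0"
    using root by (simp add: power3_eq_cube)
  then have "\<sigma> (t * t * t + to_ac (- g) * t + to_ac h) = to_ac 0"
    using \<sigma>(2)[of 0] by (simp del: to_ac_minus)
  moreover have "\<sigma> (t * t * t + to_ac (- g) * t + to_ac h) = \<sigma> t * \<sigma> t * \<sigma> t + to_ac (- g) * \<sigma> t + to_ac h"
    by (simp only: \<sigma> closed)
  ultimately show x: "is_root (\<sigma> t)" by (simp add: is_root_def power3_eq_cube)
  have "\<sigma> (quad t a b c) = quad (\<sigma> t) a b c" for a b c
    unfolding quad_def power2_eq_square by (simp only: \<sigma> closed)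
  then show "\<sigma> = conj_map (\<sigma> t)"
    using \<sigma>(1) by (intro extensionalityI[of _ "quads t"]) (auto elim!: quadsE simp: conj_map_quad, simp add: conj_map_def)
qed

lemma bij_betw_embeddings: "bij_betw (\<lambda>j. conj_map (root_of j)) UNIV (embeddings (quads t))"
proof (rule bij_betw_imageI)
  have conj_t: "conj_map x t = x" for x
    using conj_map_quad[of x 0 1 0] by simp
  show "inj (\<lambda>j. conj_map (root_of j))"
    using inj_root_of conj_t unfolding inj_def by metis
  show "range (\<lambda>j. conj_map (root_of j)) = embeddings (quads t)"
  proof
    show "embeddings (quads t) \<subseteq> range (\<lambda>j. conj_map (root_of j))"
    proof
      fix \<sigma> assume \<sigma>: "\<sigma> \<in> embeddings (quads t)"
      have "root_of 1 = t" "root_of 2 = t + s" "root_of 3 = t - s" by (simp_all add: root_of_def)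
      then obtain j where "\<sigma> t = root_of j"
        using embedding_eq_conj_map(1)[OF \<sigma>] unfolding is_root_iff by metis
      then show "\<sigma> \<in> range (\<lambda>j. conj_map (root_of j))"
        using embedding_eq_conj_map(2)[OF \<sigma>] by auto
    qed
  qed (use conj_map_embedding root_of_root in auto)
qed

text \<open>
  The matrix of conjugates is the coordinate matrix times the Vandermonde matrix of the three roots, whose
  determinant is \<open>2 s\<^sup>3\<close>; its square \<open>4 g\<^sup>3\<close> is \<open>g\<^sup>3\<close> in characteristic three.
\<close>

lemma disc_quads:
  fixes C :: "'a poly fract ^ 3 ^ 3"
  shows "disc (quads t) (\<chi> k. quad t (C $ k $ 1) (C $ k $ 2) (C $ k $ 3)) = to_ac (det C) ^ 2 * to_ac g ^ 3"
proof -
  define V :: "'a ratfun_closure ^ 3 ^ 3" where "V = (\<chi> l j. if l = 1 then 1 else if l = 2 then root_of j else root_of j ^ 2)"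
  define C' :: "'a ratfun_closure ^ 3 ^ 3" where "C' = (\<chi> k l. to_ac (C $ k $ l))"
  have "(\<chi> k j. conj_map (root_of j) ((\<chi> k. quad t (C $ k $ 1) (C $ k $ 2) (C $ k $ 3)) $ k)) = C' ** V"
    by (simp add: vec_eq_iff matrix_matrix_mult_def C'_def V_def sum_3 conj_map_quad) (simp add: quad_def)
  then have "disc (quads t) (\<chi> k. quad t (C $ k $ 1) (C $ k $ 2) (C $ k $ 3)) = (det C' * det V) ^ 2"
    by (simp add: disc_eq[OF bij_betw_embeddings] det_mul)
  moreover have "det C' = to_ac (det C)" by (simp add: C'_def det_3)
  moreover have "det V = 2 * s ^ 3"
    unfolding V_def det_3 by (simp add: root_of_def) Groebner_Basis.algebra
  moreover have "(2 * s ^ 3) ^ 2 = to_ac g ^ 3 + 3 * s ^ 6"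
    unfolding s_square[symmetric] by Groebner_Basis.algebra
  ultimately show ?thesis by (simp add: power_mult_distrib three_ac)
qed

lemma disc_powers: "disc (quads t) (vector [1, t, t\<^sup>2]) = to_ac g ^ 3"
proof -
  define C :: "'a poly fract ^ 3 ^ 3" where "C = mat 1"
  have "vector [1, t, t\<^sup>2] = (\<chi> k. quad t (C $ k $ 1) (C $ k $ 2) (C $ k $ 3))"
    by (simp add: vec_eq_iff forall_3 C_def mat_def quad_def)
  then show ?thesis by (simp add: disc_quads C_def)
qed

lemma integral_imp_coeffs_polynomial:
  assumes "quad t a b c \<in> integral_closure_in F"
  shows "sigma1 c \<in> range to_fract" "sigma2 a b c \<in> range to_fract" "norm_form g h a b c \<in> range to_fract"
proof -
  obtain p :: "'a poly poly" where p: "lead_coeff p = 1" "poly (map_poly of_base p) (quad t a b c) = 0"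
    using assms by (auto simp: integral_closure_in_def)
  have "char_poly a b c dvd map_poly to_fract p ^ 3"
    using p(2) unfolding map_poly_of_base by (rule char_poly_dvd_cube)
  then obtain H where "char_poly a b c * H = map_poly to_fract (p ^ 3)"
    by (metis dvdE fract_poly_mult power3_eq_cube)
  moreover have "lead_coeff (p ^ 3) = 1" using p(1) by (simp add: lead_coeff_power)
  moreover have "lead_coeff (char_poly a b c) = 1" by (simp add: char_poly_def)
  ultimately obtain G where G: "char_poly a b c = map_poly to_fract G"
    by (rule monic_factor_of_integral_poly)
  have "coeff (char_poly a b c) k \<in> range to_fract" for k
    unfolding G by (simp add: coeff_map_poly)
  from this[of 0] this[of 1] this[of 2]
  have "- norm_form g h a b c \<in> range to_fract" "sigma2 a b c \<in> range to_fract" "- sigma1 c \<in> range to_fract"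
    by (simp_all add: char_poly_def numeral_2_eq_2)
  moreover have "x \<in> range to_fract" if x: "- x \<in> range to_fract" for x :: "'a poly fract"
  proof -
    obtain q where "- x = to_fract q" using x by blast
    then have "x = to_fract (- q)" by (metis add.inverse_inverse to_fract_uminus)
    then show ?thesis by blast
  qed
  ultimately show "sigma1 c \<in> range to_fract" "sigma2 a b c \<in> range to_fract"
      "norm_form g h a b c \<in> range to_fract"
    by blast+
qed

lemma integral_if_coeffs_polynomial:
  assumes "sigma1 c = to_fract u" "sigma2 a b c = to_fract v" "norm_form g h a b c = to_fract w"
  shows "quad t a b c \<in> integral_closure_in (quads t)"
proof -
  have "map_poly of_base [:- w, v, - u, 1:] = map_poly to_ac (char_poly a b c)"
    unfolding map_poly_of_base char_poly_def assms by (simp add: map_poly_pCons)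
  then have "poly (map_poly of_base [:- w, v, - u, 1:]) (quad t a b c) = 0"
    by (simp only: char_poly_root)
  moreover have "lead_coeff [:- w, v, - u, 1:] = 1" by simp
  ultimately show ?thesis unfolding integral_closure_in_def by blast
qed

end

section \<open>Bases of modules over the polynomial ring\<close>

definition poly_comb :: "(3 \<Rightarrow> 'a::field poly) \<Rightarrow> 'a ratfun_closure ^ 3 \<Rightarrow> 'a ratfun_closure" where
  "poly_comb u b = (\<Sum>k\<in>UNIV. of_base (u k) * b $ k)"

lemma poly_comb_vector:
  "poly_comb u (vector [x, y, z]) = of_base (u 1) * x + of_base (u 2) * y + of_base (u 3) * z"
  by (simp add: poly_comb_def sum_3)

text \<open>
  Linear independence of a family indexed by \<open>3\<close>, as opposed to that of a set, already entails that its
  members are distinct: otherwise the difference of two equal members is a relation.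
\<close>

lemma is_poly_basis_iff:
  fixes b :: "'a::field ratfun_closure ^ 3"
  shows "is_poly_basis M b \<longleftrightarrow>
    (\<forall>u. poly_comb u b = 0 \<longrightarrow> (\<forall>k. u k = 0)) \<and> M = range (\<lambda>u. poly_comb u b)"
proof (cases "inj (\<lambda>k. b $ k)")
  case inj: True
  interpret P: Modules.module "poly_scale :: 'a poly \<Rightarrow> _" by (rule module_poly_scale)
  let ?v = "\<lambda>k. b $ k"
  have sum: "(\<Sum>v\<in>range ?v. poly_scale (u v) v) = poly_comb (\<lambda>k. u (?v k)) b" for u
    by (simp add: sum.reindex[OF inj] poly_scale_def poly_comb_def)
  have inv: "u = (\<lambda>k. (u \<circ> inv_into UNIV ?v) (?v k))" for u :: "3 \<Rightarrow> 'a poly"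
    using inj by (simp add: fun_eq_iff)
  have "\<not> P.dependent (range ?v) \<longleftrightarrow>
      (\<forall>u. poly_comb (\<lambda>k. u (?v k)) b = 0 \<longrightarrow> (\<forall>k. u (?v k) = 0))"
    by (simp add: P.dependent_finite sum) blast
  also have "\<dots> \<longleftrightarrow> (\<forall>u :: 3 \<Rightarrow> 'a poly. poly_comb u b = 0 \<longrightarrow> (\<forall>k. u k = 0))"
  proof safe
    fix u :: "3 \<Rightarrow> 'a poly" and k
    assume "\<forall>u. poly_comb (\<lambda>k. u (?v k)) b = 0 \<longrightarrow> (\<forall>k. u (?v k) = 0)"
      and "poly_comb u b = 0"
    then show "u k = 0" by (subst inv, subst (asm) inv) blast
  next
    fix u :: "'a ratfun_closure \<Rightarrow> 'a poly" and k
    assume "\<forall>u :: 3 \<Rightarrow> 'a poly. poly_comb u b = 0 \<longrightarrow> (\<forall>k. u k = 0)"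
      and "poly_comb (\<lambda>k. u (?v k)) b = 0"
    then show "u (?v k) = 0" by (elim allE[of _ "\<lambda>k. u (?v k)"]) blast
  qed
  moreover have "P.span (range ?v) = range (\<lambda>u. poly_comb u b)"
  proof -
    have "P.span (range ?v) = range (\<lambda>u. poly_comb (\<lambda>k. u (?v k)) b)"
      by (simp add: P.span_finite sum)
    also have "\<dots> = range (\<lambda>u. poly_comb u b)"
    proof safe
      fix u :: "3 \<Rightarrow> 'a poly"
      show "poly_comb u b \<in> range (\<lambda>u. poly_comb (\<lambda>k. u (?v k)) b)"
        by (subst inv) blast
    qed (rule range_eqI, rule refl)
    finally show ?thesis .
  qed
  ultimately show ?thesis using inj by (auto simp: is_poly_basis_def)
next
  case False
  then obtain k l where kl: "k \<noteq> l" "b $ k = b $ l" by (auto simp: inj_def)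
  define u :: "3 \<Rightarrow> 'a poly" where "u = (\<lambda>j. if j = k then 1 else if j = l then - 1 else 0)"
  have "poly_comb u b = (\<Sum>j\<in>{k, l}. of_base (u j) * b $ j)"
    unfolding poly_comb_def by (rule sum.mono_neutral_right) (auto simp: u_def)
  also have "\<dots> = 0" using kl by (simp add: u_def)
  finally have "poly_comb u b = 0" .
  moreover have "u k \<noteq> 0" by (simp add: u_def)
  ultimately show ?thesis using False unfolding is_poly_basis_def by blast
qed

text \<open>
  The two matrices that express the bases in terms of each other are mutually inverse.
\<close>

lemma basis_change_unit_det:
  fixes b b' :: "'a::field ratfun_closure ^ 3"
  assumes b: "is_poly_basis M b" and b': "is_poly_basis M b'"
  obtains U :: "'a poly ^ 3 ^ 3" and c where
    "\<And>k. b' $ k = poly_comb (($) (U $ k)) b" "det U = [:c:]" "c \<noteq> 0"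
proof -
  have ind: "poly_comb u b = 0 \<Longrightarrow> u k = 0" for u k
    using b unfolding is_poly_basis_iff by blast
  have M: "M = range (\<lambda>u. poly_comb u b)" "M = range (\<lambda>u. poly_comb u b')"
    by (rule b[unfolded is_poly_basis_iff, THEN conjunct2] b'[unfolded is_poly_basis_iff, THEN conjunct2])+
  have unit: "d $ k = poly_comb (\<lambda>l. if k = l then 1 else 0) d" for d :: "'a ratfun_closure ^ 3" and k
    using exhaust_3[of k] by (elim disjE) (simp_all add: poly_comb_def sum_3)
  have "b' $ k \<in> M" "b $ k \<in> M" for k
    using M unit by blast+
  then have "\<forall>k. \<exists>u. b' $ k = poly_comb u b" "\<forall>k. \<exists>v. b $ k = poly_comb v b'"
    using M by (metis imageE)+
  then obtain u v where u: "\<And>k. b' $ k = poly_comb (u k) b" and v: "\<And>k. b $ k = poly_comb (v k) b'"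
    by metis
  define U V :: "'a poly ^ 3 ^ 3" where "U = (\<chi> k l. u k l)" and "V = (\<chi> k l. v k l)"
  have "V ** U = mat 1"
  proof -
    have "(\<Sum>k\<in>UNIV. v j k * u k l) - (if j = l then 1 else 0) = 0" for j l
    proof (rule ind[of "\<lambda>l. (\<Sum>k\<in>UNIV. v j k * u k l) - (if j = l then 1 else 0)"])
      have "poly_comb (\<lambda>l. (\<Sum>k\<in>UNIV. v j k * u k l) - (if j = l then 1 else 0)) b
          = (\<Sum>k\<in>UNIV. of_base (v j k) * poly_comb (u k) b) - poly_comb (\<lambda>l. if j = l then 1 else 0) b"
        by (simp add: poly_comb_def sum_3 algebra_simps)
      also have "\<dots> = poly_comb (v j) b' - b $ j"
        by (simp add: poly_comb_def[of "v j"] flip: u unit)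
      also have "\<dots> = 0" by (simp flip: v)
      finally show "poly_comb (\<lambda>l. (\<Sum>k\<in>UNIV. v j k * u k l) - (if j = l then 1 else 0)) b = 0" .
    qed
    then show ?thesis
      by (simp add: vec_eq_iff matrix_matrix_mult_def U_def V_def mat_def)
  qed
  then have "det V * det U = 1" by (metis det_mul det_I)
  then have "det U dvd 1" by (metis dvd_triv_right)
  then obtain c where c: "det U = [:c:]" "c dvd 1" by (auto simp: is_unit_poly_iff)
  moreover have "c \<noteq> 0" using c by auto
  moreover have "b' $ k = poly_comb (($) (U $ k)) b" for k
    unfolding u poly_comb_def U_def by simp
  ultimately show thesis using that by blast
qed

lemma is_poly_basis_scale_first:
  fixes c :: "'a::field"
  assumes "is_poly_basis M (vector [x, y, z])" "c \<noteq> 0"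
  shows "is_poly_basis M (vector [of_base [:c:] * x, y, z])"
proof -
  let ?b = "vector [x, y, z] :: 'a ratfun_closure ^ 3"
  let ?b' = "vector [of_base [:c:] * x, y, z] :: 'a ratfun_closure ^ 3"
  have cc: "[:c:] * [:inverse c:] = 1" using assms(2) by (simp add: one_pCons)
  have scale: "poly_comb u ?b' = poly_comb (u(1 := u 1 * [:c:])) ?b" for u
    by (simp add: poly_comb_vector del: mult_pCons_right)
  have unscale: "poly_comb u ?b = poly_comb (u(1 := u 1 * [:inverse c:])) ?b'" for u
  proof -
    have "u 1 * [:inverse c:] * [:c:] = u 1" using cc by (simp only: ac_simps mult_1_left)
    then show ?thesis unfolding scale by (simp only: fun_upd_upd fun_upd_same fun_upd_triv)
  qed
  have ind: "poly_comb u ?b = 0 \<Longrightarrow> u k = 0" for u k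
    using assms(1) unfolding is_poly_basis_iff by blast
  have M: "M = range (\<lambda>u. poly_comb u ?b)"
    by (rule assms(1)[unfolded is_poly_basis_iff, THEN conjunct2])
  have "range (\<lambda>u. poly_comb u ?b) = range (\<lambda>u. poly_comb u ?b')"
    by (auto simp: image_iff intro: scale unscale)
  then have M': "M = range (\<lambda>u. poly_comb u ?b')" using M by simp
  show ?thesis unfolding is_poly_basis_iff
  proof (intro conjI allI impI)
    fix u :: "3 \<Rightarrow> 'a poly" and k
    assume "poly_comb u ?b' = 0"
    then have "(u(1 := u 1 * [:c:])) k = 0" unfolding scale by (rule ind)
    then show "u k = 0" using assms(2) by (auto split: if_splits)
  qed (fact M')
qed

section \<open>The ring of integers\<close>

lemma norm_form_lattice_coords:
  fixes I m n w a b c :: "'a::idom"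
  assumes "n\<^sup>2 = w * I"
  shows "norm_form (m * I) (n * I) (a - m * (c * I)) b c = lattice_norm I m n w a b (c * I)"
  using assms unfolding norm_form_def lattice_norm_def by Groebner_Basis.algebra

lemma lattice_norm_homogeneous:
  "lattice_norm I m n w (d * a) (d * b) (d * c) = d ^ 3 * lattice_norm I m n w a b c"
  unfolding lattice_norm_def by Groebner_Basis.algebra

lemma to_fract_numeral [simp]: "to_fract (numeral k) = numeral k"
proof -
  have "to_fract (of_nat j) = of_nat j" for j by (induction j) simp_all
  from this[of "numeral k"] show ?thesis by simp
qed

lemma to_fract_lattice_norm:
  "to_fract (lattice_norm I m n w a b c) = lattice_norm (to_fract I) (to_fract m) (to_fract n) (to_fract w)
     (to_fract a) (to_fract b) (to_fract c)"
  by (simp add: lattice_norm_def)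

locale maximal_order =
  M: maximal_admissible A B I i N m n w +
  C: function_field_cubic "to_fract A" "to_fract N" \<rho>
  for A B I i N m n w :: "'a::{field,finite} poly" and \<rho> :: "'a ratfun_closure"
begin

definition \<omega> :: "'a ratfun_closure" where "\<omega> = (\<rho>\<^sup>2 - of_base A) / of_base I"

lemma tf_A: "to_fract A = to_fract m * to_fract I" and tf_N: "to_fract N = to_fract n * to_fract I"
  and tf_n: "(to_fract n)\<^sup>2 = to_fract w * to_fract I"
  using arg_cong[OF M.A_eq, of to_fract] arg_cong[OF M.N_eq, of to_fract] arg_cong[OF M.n_square, of to_fract]
  by simp_all

lemma poly_comb_eq_quad:
  "poly_comb u (vector [1, \<rho>, \<omega>]) =
     quad \<rho> (to_fract (u 1) - to_fract m * to_fract (u 3)) (to_fract (u 2)) (to_fract (u 3) / to_fract I)"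
proof -
  have \<omega>: "\<omega> = \<rho>\<^sup>2 / to_ac (to_fract I) - to_ac (to_fract m)"
    using M.I_nz by (simp add: \<omega>_def of_base_eq tf_A diff_divide_distrib del: to_fract_mult)
  show ?thesis
    unfolding poly_comb_vector quad_def \<omega> by (simp add: of_base_eq algebra_simps)
qed

lemma char_coeffs:
  fixes a b c :: "'a poly fract"
  shows "C.sigma1 c = 2 * (to_fract m * (c * to_fract I))"
    and "C.sigma2 (a - to_fract m * (c * to_fract I)) b c = a * (c * to_fract I) * to_fract m - b\<^sup>2 * to_fract A"
    and "norm_form (to_fract A) (to_fract N) (a - to_fract m * (c * to_fract I)) b c =
      lattice_norm (to_fract I) (to_fract m) (to_fract n) (to_fract w) a b (c * to_fract I)"
proof -
  show "C.sigma1 c = 2 * (to_fract m * (c * to_fract I))"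
    unfolding C.sigma1_def unfolding tf_A by (simp add: ac_simps)
  show "C.sigma2 (a - to_fract m * (c * to_fract I)) b c = a * (c * to_fract I) * to_fract m - b\<^sup>2 * to_fract A"
    unfolding C.sigma2_def unfolding tf_A by Groebner_Basis.algebra
  show "norm_form (to_fract A) (to_fract N) (a - to_fract m * (c * to_fract I)) b c =
      lattice_norm (to_fract I) (to_fract m) (to_fract n) (to_fract w) a b (c * to_fract I)"
    unfolding tf_A tf_N by (rule norm_form_lattice_coords[OF tf_n])
qed

lemma poly_comb_integral: "poly_comb u (vector [1, \<rho>, \<omega>]) \<in> integral_closure_in (quads \<rho>)"
proof -
  define c where "c = to_fract (u 3) / to_fract I"
  have c: "c * to_fract I = to_fract (u 3)" using M.I_nz by (simp add: c_def)
  have "quad \<rho> (to_fract (u 1) - to_fract m * (c * to_fract I)) (to_fract (u 2)) c \<in> integral_closure_in (quads \<rho>)"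
  proof (rule C.integral_if_coeffs_polynomial)
    show "C.sigma1 c = to_fract (m * u 3 + m * u 3)" by (simp add: char_coeffs c)
    show "C.sigma2 (to_fract (u 1) - to_fract m * (c * to_fract I)) (to_fract (u 2)) c =
        to_fract (u 1 * u 3 * m - (u 2)\<^sup>2 * A)"
      unfolding char_coeffs unfolding c by simp
    show "norm_form (to_fract A) (to_fract N) (to_fract (u 1) - to_fract m * (c * to_fract I)) (to_fract (u 2)) c =
        to_fract (lattice_norm I m n w (u 1) (u 2) (u 3))"
      unfolding char_coeffs unfolding c to_fract_lattice_norm ..
  qed
  then show ?thesis unfolding poly_comb_eq_quad c_def using M.I_nz by simp
qed

text \<open>
  Over a common denominator \<open>d\<close> of the coordinates, integrality turns into the hypotheses of
  \<open>denominator_dvd\<close>, so \<open>d\<close> cancels.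
\<close>

lemma integral_imp_poly_comb:
  assumes "z \<in> integral_closure_in (quads \<rho>)"
  shows "z \<in> range (\<lambda>u. poly_comb u (vector [1, \<rho>, \<omega>]))"
proof -
  have "z \<in> quads \<rho>" using assms by (simp add: integral_closure_in_def)
  then obtain a' b c where z': "z = quad \<rho> a' b c" by (rule quadsE)
  define a e where "a = a' + to_fract m * (c * to_fract I)" and "e = c * to_fract I"
  have z: "z = quad \<rho> (a - to_fract m * (c * to_fract I)) b c" by (simp add: z' a_def)
  obtain d p q r where d: "d \<noteq> 0" "to_fract d * a = to_fract p" "to_fract d * b = to_fract q"
      "to_fract d * e = to_fract r"
    by (rule common_denominator)
  note coeffs = C.integral_imp_coeffs_polynomial[OF assms[unfolded z]]
  obtain t1 where t1: "2 * (to_fract m * e) = to_fract t1"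
    using coeffs(1) unfolding char_coeffs unfolding e_def[symmetric] by (rule rangeE)
  obtain t2 where t2: "a * e * to_fract m - b\<^sup>2 * to_fract A = to_fract t2"
    using coeffs(2) unfolding char_coeffs unfolding e_def[symmetric] by (rule rangeE)
  obtain t3 where t3: "lattice_norm (to_fract I) (to_fract m) (to_fract n) (to_fract w) a b e = to_fract t3"
    using coeffs(3) unfolding char_coeffs unfolding e_def[symmetric] by (rule rangeE)
  have "to_fract (2 * (m * r)) = to_fract (d * t1)"
    by (simp flip: t1 d(4))
  then have "d dvd 2 * (m * r)" unfolding to_fract_eq_iff by simp
  moreover have "m * r = - (2 * (m * r)) + 3 * (m * r)" by Groebner_Basis.algebra
  ultimately have 1: "d dvd m * r" by (metis M.three_poly add.right_neutral dvd_minus_iff mult_zero_left)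
  have "to_fract (p * r * m - q\<^sup>2 * A) = to_fract (d\<^sup>2 * t2)"
    by (simp add: power2_eq_square algebra_simps flip: t2 d(2-4))
  then have 2: "d\<^sup>2 dvd p * r * m - q\<^sup>2 * A" unfolding to_fract_eq_iff by simp
  have "to_fract (lattice_norm I m n w p q r) = to_fract (d ^ 3 * t3)"
    unfolding to_fract_lattice_norm by (simp add: lattice_norm_homogeneous flip: t3 d(2-4))
  then have 3: "d ^ 3 dvd lattice_norm I m n w p q r" unfolding to_fract_eq_iff by simp
  obtain p1 q1 r1 where "p = d * p1" "q = d * q1" "r = d * r1"
    using M.denominator_dvd[OF d(1) 1 2 3] by (auto elim!: dvdE)
  then have abe: "a = to_fract p1" "b = to_fract q1" "e = to_fract r1" using d by simp_all
  define u :: "3 \<Rightarrow> 'a poly" where "u = (\<lambda>k. if k = 1 then p1 else if k = 2 then q1 else r1)"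
  have "c = to_fract r1 / to_fract I" using abe(3) M.I_nz by (simp add: e_def field_simps)
  then have "z = poly_comb u (vector [1, \<rho>, \<omega>])"
    unfolding z poly_comb_eq_quad e_def[symmetric] abe by (simp add: u_def)
  then show ?thesis by blast
qed

lemma integral_basis: "is_poly_basis (integral_closure_in (quads \<rho>)) (vector [1, \<rho>, \<omega>])"
  unfolding is_poly_basis_iff
proof (intro conjI allI impI)
  fix u :: "3 \<Rightarrow> 'a poly" and k
  assume "poly_comb u (vector [1, \<rho>, \<omega>]) = 0"
  then have "u 1 = 0 \<and> u 2 = 0 \<and> u 3 = 0"
    unfolding poly_comb_eq_quad C.quad_eq_0_iff[OF C.root_t] using M.I_nz by auto
  then show "u k = 0" using exhaust_3[of k] by auto
next
  show "integral_closure_in (quads \<rho>) = range (\<lambda>u. poly_comb u (vector [1, \<rho>, \<omega>]))"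
    using poly_comb_integral integral_imp_poly_comb by blast
qed

lemma disc_poly_comb:
  "disc (quads \<rho>) (\<chi> k. poly_comb (($) (U $ k)) (vector [1, \<rho>, \<omega>])) =
     of_base (det U) ^ 2 * (of_base A ^ 3 / of_base I ^ 2)"
proof -
  define V :: "'a poly fract ^ 3 ^ 3" where
    "V = (\<chi> k l. if l = 1 then to_fract (U $ k $ 1) - to_fract m * to_fract (U $ k $ 3)
       else if l = 2 then to_fract (U $ k $ 2) else to_fract (U $ k $ 3) / to_fract I)"
  have "det V = to_fract (det U) / to_fract I"
    unfolding V_def det_3 using M.I_nz by (simp add: field_simps)
  moreover have "(\<chi> k. poly_comb (($) (U $ k)) (vector [1, \<rho>, \<omega>])) = (\<chi> k. quad \<rho> (V $ k $ 1) (V $ k $ 2) (V $ k $ 3))"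
    by (simp add: poly_comb_eq_quad V_def)
  ultimately show ?thesis by (simp add: C.disc_quads of_base_eq power_divide)
qed

text \<open>
  Scaling the first basis element by a constant \<open>c\<close> realises every value; the determinant of a change
  of basis shows that there are no others.
\<close>

lemma discriminants_eq:
  "discriminants (quads \<rho>) = {of_base [:c:] ^ 2 * (of_base A ^ 3 / of_base I ^ 2) | c. c \<noteq> 0}"
proof safe
  fix x assume "x \<in> discriminants (quads \<rho>)"
  then obtain b where x: "x = disc (quads \<rho>) b" and b: "is_poly_basis (integral_closure_in (quads \<rho>)) b"
    by (auto simp: discriminants_def)
  obtain U c where U: "\<And>k. b $ k = poly_comb (($) (U $ k)) (vector [1, \<rho>, \<omega>])" "det U = [:c:]" "c \<noteq> 0"
    using basis_change_unit_det[OF integral_basis b] by metis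
  have "b = (\<chi> k. poly_comb (($) (U $ k)) (vector [1, \<rho>, \<omega>]))"
    using U(1) by (simp add: vec_eq_iff)
  then show "\<exists>c. x = of_base [:c:] ^ 2 * (of_base A ^ 3 / of_base I ^ 2) \<and> c \<noteq> 0"
    unfolding x using disc_poly_comb[of U] U(2,3) by auto
next
  fix c :: 'a assume c: "c \<noteq> 0"
  define b where "b = (vector [of_base [:c:] * 1, \<rho>, \<omega>] :: 'a ratfun_closure ^ 3)"
  have basis: "is_poly_basis (integral_closure_in (quads \<rho>)) b"
    unfolding b_def by (rule is_poly_basis_scale_first[OF integral_basis c])
  define U :: "'a poly ^ 3 ^ 3" where "U = (\<chi> k l. if k = l then if k = 1 then [:c:] else 1 else 0)"
  have "det U = [:c:]" by (simp add: U_def det_3)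
  moreover have "(\<chi> k. poly_comb (($) (U $ k)) (vector [1, \<rho>, \<omega>])) = b"
    by (simp add: vec_eq_iff forall_3 b_def poly_comb_vector U_def)
  ultimately have "disc (quads \<rho>) b = of_base [:c:] ^ 2 * (of_base A ^ 3 / of_base I ^ 2)"
    using disc_poly_comb[of U] by simp
  then show "of_base [:c:] ^ 2 * (of_base A ^ 3 / of_base I ^ 2) \<in> discriminants (quads \<rho>)"
    using basis unfolding discriminants_def by (metis (mono_tags, lifting) mem_Collect_eq)
qed

end

theorem mainTheorem1:
  fixes A B I i :: "'a::{field,finite} poly"
    and y \<rho> \<omega> :: "'a ratfun_closure"
    and F :: "'a ratfun_closure set"
    and n :: nat
  assumes q: "CARD('a) = 3 ^ n"
    and A_nz: "A \<noteq> 0"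
    and irr: "absolutely_irreducible (cubic A B)"
    and std: "standard_form A B"
    and y: "y ^ 3 - of_base A * y + of_base B = 0"
    and F: "F = adjoin y"
    and adm: "admissible A B I i"
    and max_deg: "\<And>I' i'. admissible A B I' i' \<Longrightarrow> degree I' \<le> degree I"
    and \<rho>: "\<rho> = y - of_base i"
    and \<omega>: "\<omega> = (y ^ 2 + of_base i * y + of_base i ^ 2 - of_base A) / of_base I"
  shows "is_poly_basis (integral_closure_in F) (vector [1, \<rho>, \<omega>]) \<and>
    indices F y = {of_base [:c:] * of_base I | c. c \<noteq> 0} \<and>
    discriminants F = {of_base [:c:] ^ 2 * (of_base A ^ 3 / of_base I ^ 2) | c. c \<noteq> 0}"
proof -
  define N where "N = cubic_at A B i"
  have three: "(3::'a) = 0" using q by (rule three_eq_0_if_card_power_3)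
  have I_nz: "I \<noteq> 0" using adm by (auto simp: admissible_def)
  have dvd: "I dvd A" "I dvd N" "I ^ 3 dvd N\<^sup>2"
    using adm by (auto simp: admissible_def N_def cubic_at_def)
  interpret M: maximal_admissible A B I i N "A div I" "N div I" "N\<^sup>2 div I ^ 3"
  proof
    show "\<not> Q ^ 3 dvd cubic_at A B j" if "degree Q > 0" "Q ^ 2 dvd A" for Q j
      using std that unfolding standard_form_def cubic_at_def by blast
  qed (use three I_nz dvd adm max_deg N_def in auto)
  interpret Y: function_field_cubic "to_fract A" "to_fract B" y
  proof
    show "(3 :: 'a poly fract) = 0"
      using arg_cong[OF M.three_poly, of to_fract] by (simp add: numeral_3_eq_3 flip: One_nat_def)
    show "r ^ 3 - to_fract A * r + to_fract B \<noteq> 0" for r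
      by (rule absolutely_irreducible_cubic_no_root[OF irr])
  qed (use A_nz y in \<open>simp_all add: of_base_eq\<close>)
  have "N = i ^ 3 - i * A + B" by (simp add: N_def cubic_at_def)
  then have "to_fract N = to_fract i ^ 3 - to_fract i * to_fract A + to_fract B" by simp
  then have "depressed_cubic (to_fract A) (to_fract N) \<rho>"
    using depressed_cubic_shift[OF Y.depressed_cubic_axioms, of "to_fract i"] by (simp add: \<rho> of_base_eq)
  then interpret O: maximal_order A B I i N "A div I" "N div I" "N\<^sup>2 div I ^ 3" \<rho>
    by (simp add: maximal_order_def function_field_cubic_def M.maximal_admissible_axioms)
  have F_\<rho>: "F = quads \<rho>" and F_y: "F = quads y"
    using quads_shift[of y "to_fract i"] by (simp_all add: F Y.adjoin_eq_quads \<rho> of_base_eq)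
  have "\<rho>\<^sup>2 = y ^ 2 + of_base i * y + of_base i ^ 2 - 3 * (of_base i * y)"
    unfolding \<rho> by Groebner_Basis.algebra
  then have "\<rho>\<^sup>2 = y ^ 2 + of_base i * y + of_base i ^ 2" by (simp add: Y.three_ac)
  then have \<omega>': "\<omega> = O.\<omega>" by (simp add: \<omega> O.\<omega>_def)
  have discs: "discriminants F = {of_base [:c:] ^ 2 * (of_base A ^ 3 / of_base I ^ 2) | c. c \<noteq> 0}"
    unfolding F_\<rho> by (rule O.discriminants_eq)
  have "indices F y = {of_base [:c:] * of_base I | c. c \<noteq> 0}"
  proof -
    have disc_y: "disc F (vector [1, y, y\<^sup>2]) = of_base A ^ 3"
      unfolding F_y by (simp add: Y.disc_powers of_base_eq)
    have nz: "of_base A \<noteq> 0" "of_base I \<noteq> 0" using A_nz I_nz by simp_all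
    have inverse_const: "of_base [:c:] * of_base [:inverse c:] = 1" if "c \<noteq> 0" for c :: 'a
      using that by (simp add: one_pCons flip: of_base_simps)
    have index_iff: "of_base A ^ 3 = J\<^sup>2 * (of_base [:c:] ^ 2 * (of_base A ^ 3 / of_base I ^ 2)) \<longleftrightarrow>
        J = of_base [:inverse c:] * of_base I \<or> J = of_base [:- inverse c:] * of_base I"
      if "c \<noteq> 0" for J and c :: 'a
    proof -
      have "of_base A ^ 3 = J\<^sup>2 * (of_base [:c:] ^ 2 * (of_base A ^ 3 / of_base I ^ 2)) \<longleftrightarrow>
          (J * of_base [:c:])\<^sup>2 = (of_base I)\<^sup>2"
        using nz by (auto simp: field_simps power_mult_distrib)
      also have "\<dots> \<longleftrightarrow> J * of_base [:c:] = of_base I \<or> J * of_base [:c:] = - of_base I"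
        by (rule power2_eq_iff)
      also have "\<dots> \<longleftrightarrow> J = of_base [:inverse c:] * of_base I \<or> J = of_base [:- inverse c:] * of_base I"
      proof -
        have "of_base [:inverse c:] = inverse (of_base [:c:])"
          using inverse_unique[OF inverse_const[OF that]] ..
        moreover have "of_base [:- inverse c:] = - of_base [:inverse c:]"
          by (simp flip: of_base_simps(5))
        moreover have "of_base [:c:] \<noteq> 0" using that by simp
        ultimately show ?thesis by (simp add: nonzero_eq_divide_eq[symmetric] divide_inverse ac_simps)
      qed
      finally show ?thesis .
    qed
    show ?thesis
    proof safe
      fix J assume "J \<in> indices F y"
      then obtain c where "c \<noteq> 0" "of_base A ^ 3 = J\<^sup>2 * (of_base [:c:] ^ 2 * (of_base A ^ 3 / of_base I ^ 2))"
        unfolding indices_def discs disc_y by auto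
      then have "J = of_base [:inverse c:] * of_base I \<or> J = of_base [:- inverse c:] * of_base I"
        using index_iff by blast
      then show "\<exists>c. J = of_base [:c:] * of_base I \<and> c \<noteq> 0"
        using \<open>c \<noteq> 0\<close> by (metis inverse_nonzero_iff_nonzero neg_equal_0_iff_equal)
    next
      fix c :: 'a assume c: "c \<noteq> 0"
      then have "of_base A ^ 3 = (of_base [:c:] * of_base I)\<^sup>2 *
          (of_base [:inverse c:] ^ 2 * (of_base A ^ 3 / of_base I ^ 2))"
        using index_iff[of "inverse c"] by simp
      then show "of_base [:c:] * of_base I \<in> indices F y"
        unfolding indices_def discs disc_y using c by (auto intro!: exI[of _ "inverse c"])
    qed
  qed
  moreover have "is_poly_basis (integral_closure_in F) (vector [1, \<rho>, \<omega>])"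
    unfolding F_\<rho> \<omega>' by (rule O.integral_basis)
  ultimately show ?thesis using discs by blast
qed

end
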